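(* Let $q\ge 5$ be a prime power. Let $\mathcal{C}$ be a $[q,q-3,4]_q$ GRS code whose parity check matrix is obtained by removing any one column from the $3\times(q+1)$ matrix $H_4$ whose columns are nonzero scalar multiples of $(1,t,t^2)^{tr}$, $t\in\mathbb{F}_q$, and of $(0,0,1)^{tr}$ (so $\mathcal{C}$ corresponds to the conic in $\mathrm{PG}(2,q)$ with one point removed). Put $n=q$. Then $\mathcal{C}$ has covering radius $3$, and the weight distributions of its cosets are as follows. There are $q(q-1)$ cosets of weight $1$, all with weight distribution $D_1$. Moreover: (i) If $q$ is odd, the weight $2$ cosets are partitioned into two classes: $(q-1)\frac{q^2+q}{2}$ cosets with distribution $D_2\left(\frac{q-1}{2}\right)$ and $(q-1)\frac{q^2-q}{2}$ cosets with distribution $D_2\left(\frac{q-3}{2}\right)$; there are $q-1$ cosets of weight $3$, all with distribution $D_3$. (ii) If $q$ is even, the weight $2$ cosets are partitioned into two classes: $(q-1)^2$ cosets with distribution $D_2\left(\frac q2\right)$ and $(q-1)(q^2-q)$ cosets with distribution $D_2\left(\frac{q-2}{2}\right)$; there are $2(q-1)$ cosets of weight $3$, all with distribution $D_3$. In both cases, for weight $2$ cosets $\mathcal{V}_a,\mathcal{V}_b$ in distinct classes, $$(-1)^{n}B_w(\mathcal{V}_a)-B_{n+2-w}(\mathcal{V}_a)=(-1)^{n}B_w(\mathcal{V}_b)-B_{n+2-w}(\mathcal{V}_b),\quad w=3,\ldots,n.$$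
   Context: For an $[n,n-3,4]_q$ code $\mathcal{C}$ (linear, length $n$, dimension $n-3$, minimum distance $4$), a coset is a translate $\mathcal{C}+\mathbf{v}$; its weight is the smallest Hamming weight of a vector in it. The covering radius is the least $R$ such that every vector of $\mathbb{F}_q^n$ is within Hamming distance $R$ of a codeword. $A_w(\mathcal{C})$ (resp. $B_w(\mathcal{V})$) is the number of vectors of Hamming weight $w$ in $\mathcal{C}$ (resp. in the coset $\mathcal{V}$). Put $\Omega_w^{(v)}(n,4)=(-1)^{w-4}\binom{n-v}{w-v}\binom{w-1-v}{2-v}$. A coset $\mathcal{V}$ has weight distribution: - $D_1$ if $B_0=B_2=0$, $B_1=1$, $B_3=\binom{n-1}{3}$, and $B_w=A_w(\mathcal{C})-\Omega_w^{(0)}(n,4)+\Omega_w^{(1)}(n,4)$ for $w=4,\ldots,n$; - $D_2(i)$ if $B_0=B_1=0$, $B_2=i$, and $B_w=A_w(\mathcal{C})-\Omega_w^{(0)}(n,4)+(-1)^w\binom{n-2}{n-w}i$ for $w=3,\ldots,n$; - $D_3$ if $B_0=B_1=B_2=0$, $B_3=\binom n3$, and $B_w=A_w(\mathcal{C})-\Omega_w^{(0)}(n,4)$ for $w=4,\ldots,n$; where $B_w=B_w(\mathcal{V})$. *)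

theory Defs
  imports "HOL-Analysis.Analysis"
begin

definition hamming_weight :: "'a::zero ^ 'n::finite \<Rightarrow> nat" where
  "hamming_weight x = card {j. x $ j \<noteq> 0}"

definition hamming_dist :: "'a ^ 'n::finite \<Rightarrow> 'a ^ 'n \<Rightarrow> nat" where
  "hamming_dist x y = card {j. x $ j \<noteq> y $ j}"

definition min_distance :: "('a ^ 'n::finite) set \<Rightarrow> nat" where
  "min_distance C = (LEAST d. \<exists>x\<in>C. \<exists>y\<in>C. x \<noteq> y \<and> d = hamming_dist x y)"

definition covering_radius :: "('a ^ 'n::finite) set \<Rightarrow> nat" where
  "covering_radius C = (LEAST R. \<forall>v. \<exists>c\<in>C. hamming_dist v c \<le> R)"

text \<open>\<open>linear_code n k d q C\<close>: \<open>C\<close> is an \<open>[n,k,d]\<close> code over the field with \<open>q\<close> elements.\<close>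

definition linear_code ::
    "nat \<Rightarrow> nat \<Rightarrow> nat \<Rightarrow> nat \<Rightarrow> ('a::{field,finite} ^ 'n::finite) set \<Rightarrow> bool" where
  "linear_code n k d q C \<longleftrightarrow>
     CARD('n) = n \<and> CARD('a) = q \<and>
     vec.subspace C \<and> vec.dim C = k \<and> min_distance C = d"

definition parity_check_matrix ::
    "'a::{field,finite} ^ 'n ^ 'm \<Rightarrow> ('a ^ 'n::finite) set \<Rightarrow> bool" where
  "parity_check_matrix H C \<longleftrightarrow> C = {x. H *v x = 0}"

text \<open>Points of the conic in the projective plane. The index \<open>None\<close> is the point at infinity,
  so the type \<open>'a option\<close> indexes the \<open>q + 1\<close> columns of \<open>H4\<close>.\<close>

fun conic_point :: "'a::field option \<Rightarrow> 'a ^ 3" where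
  "conic_point (Some t) = vector [1, t, t ^ 2]"
| "conic_point None = vector [0, 0, 1]"

definition H4 :: "('a option \<Rightarrow> 'a) \<Rightarrow> 'a::{field,finite} ^ 'a option ^ 3" where
  "H4 \<mu> = (\<chi> i j. \<mu> j * conic_point j $ i)"

text \<open>The remaining columns may appear in any order, given by the enumeration \<open>\<sigma>\<close>.\<close>

definition column_removed :: "'a ^ 'm::finite ^ 'r \<Rightarrow> 'm \<Rightarrow> 'a ^ 'n::finite ^ 'r \<Rightarrow> bool" where
  "column_removed M p H \<longleftrightarrow>
     (\<exists>\<sigma>. bij_betw \<sigma> UNIV (UNIV - {p}) \<and> (\<forall>j. column j H = column (\<sigma> j) M))"

definition cosets :: "('a::field ^ 'n::finite) set \<Rightarrow> ('a ^ 'n) set set" where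
  "cosets C = range (\<lambda>v. (\<lambda>c. c + v) ` C)"

definition coset_weight :: "('a::field ^ 'n::finite) set \<Rightarrow> nat" where
  "coset_weight V = (LEAST w. \<exists>x\<in>V. hamming_weight x = w)"

definition cosets_of_weight :: "('a::field ^ 'n::finite) set \<Rightarrow> nat \<Rightarrow> ('a ^ 'n) set set" where
  "cosets_of_weight C w = {V \<in> cosets C. coset_weight V = w}"

text \<open>The number of vectors of weight \<open>w\<close> in \<open>S\<close>: this is \<open>A\<^sub>w\<close> when \<open>S\<close> is the code and
  \<open>B\<^sub>w\<close> when \<open>S\<close> is a coset. It is an integer, as the formulas below involve signs.\<close>

definition weight_count :: "('a::zero ^ 'n::finite) set \<Rightarrow> nat \<Rightarrow> int" where
  "weight_count S w = int (card {x \<in> S. hamming_weight x = w})"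

text \<open>\<open>Omega n v w\<close> is \<open>\<Omega>\<^sub>w\<^sup>(\<^sup>v\<^sup>)(n, 4)\<close>, with sign \<open>(-1)\<^sup>w\<^sup>-\<^sup>4 = (-1)\<^sup>w\<close>. It is used for \<open>v \<le> 1\<close>
  and \<open>w \<ge> 3\<close> only, where \<open>w - 4\<close> may be negative but none of the natural-number
  subtractions below truncates.\<close>

definition Omega :: "nat \<Rightarrow> nat \<Rightarrow> nat \<Rightarrow> int" where
  "Omega n v w = (- 1) ^ w * int ((n - v) choose (w - v)) * int ((w - 1 - v) choose (2 - v))"

definition D1 :: "('a::field ^ 'n::finite) set \<Rightarrow> ('a ^ 'n) set \<Rightarrow> bool" where
  "D1 C V \<longleftrightarrow> (let n = CARD('n); A = weight_count C; B = weight_count V in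
     B 0 = 0 \<and> B 2 = 0 \<and> B 1 = 1 \<and> B 3 = int ((n - 1) choose 3) \<and>
     (\<forall>w\<in>{4..n}. B w = A w - Omega n 0 w + Omega n 1 w))"

definition D2 :: "('a::field ^ 'n::finite) set \<Rightarrow> nat \<Rightarrow> ('a ^ 'n) set \<Rightarrow> bool" where
  "D2 C i V \<longleftrightarrow> (let n = CARD('n); A = weight_count C; B = weight_count V in
     B 0 = 0 \<and> B 1 = 0 \<and> B 2 = int i \<and>
     (\<forall>w\<in>{3..n}. B w = A w - Omega n 0 w + (- 1) ^ w * int ((n - 2) choose (n - w)) * int i))"

definition D3 :: "('a::field ^ 'n::finite) set \<Rightarrow> ('a ^ 'n) set \<Rightarrow> bool" where
  "D3 C V \<longleftrightarrow> (let n = CARD('n); A = weight_count C; B = weight_count V in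
     B 0 = 0 \<and> B 1 = 0 \<and> B 2 = 0 \<and> B 3 = int (n choose 3) \<and>
     (\<forall>w\<in>{4..n}. B w = A w - Omega n 0 w))"

end

theory Submission
  imports Defs
begin

text \<open>The cosets of \<open>C\<close> are the fibres \<open>{x. H x = s}\<close> over the syndromes \<open>s\<close> in the
  three-dimensional space. Any three columns of \<open>H\<close> are independent, so the number of vectors
  supported in a set \<open>J\<close> with syndrome \<open>s\<close> does not depend on \<open>s\<close> once \<open>J\<close> has at least three
  elements. Moebius inversion then expresses each \<open>B\<^sub>w\<close> through \<open>A\<^sub>w\<close>, \<open>B\<^sub>1\<close> and \<open>B\<^sub>2\<close>.

  For \<open>s\<close> off the conic, \<open>B\<^sub>2\<close> counts the secants through \<open>s\<close> that avoid the removed point \<open>p\<close>.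
  Let \<open>T\<close> be the number of conic points whose tangent passes through \<open>s\<close>. The other \<open>q + 1 - T\<close>
  points are paired off by the lines through \<open>s\<close>, and one pair is lost unless the tangent at \<open>p\<close>
  passes through \<open>s\<close>. Unless \<open>s\<close> is the nucleus (\<open>q\<close> even) we have \<open>T \<le> 2\<close>, which leaves only the
  values \<open>\<lfloor>q / 2\<rfloor>\<close> and \<open>\<lfloor>q / 2\<rfloor> - 1\<close> for \<open>B\<^sub>2\<close>. The sum of \<open>B\<^sub>2\<close> over all syndromes is the number
  of vectors of weight two, and this determines how often each value occurs.\<close>

section \<open>Vectors with prescribed support\<close>

lemma card_vec_Pi:
  "card {x :: 'a::finite ^ 'n::finite. \<forall>j. x $ j \<in> A j} = (\<Prod>j\<in>UNIV. card (A j))"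
proof -
  have "bij_betw vec_nth {x :: 'a ^ 'n. \<forall>j. x $ j \<in> A j} (\<Pi>\<^sub>E j\<in>UNIV. A j)"
    by (rule bij_betwI[where g = vec_lambda]) auto
  then show ?thesis
    by (simp add: bij_betw_same_card card_PiE)
qed

lemma prod_if_card:
  "(\<Prod>j\<in>UNIV. if j \<in> J then a else 1) = (a::nat) ^ card (J :: 'n::finite set)"
  by (simp add: prod.If_cases)

lemma card_supp_subset:
  "card {x :: 'a::{zero,finite} ^ 'n::finite. {j. x $ j \<noteq> 0} \<subseteq> J} = CARD('a) ^ card J"
proof -
  have eq: "{x :: 'a ^ 'n. {j. x $ j \<noteq> 0} \<subseteq> J} = {x. \<forall>j. x $ j \<in> (if j \<in> J then UNIV else {0})}"
    by auto
  have "(\<Prod>j\<in>UNIV. card (if j \<in> J then UNIV else {0::'a})) =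
      (\<Prod>j\<in>UNIV. if j \<in> J then CARD('a) else 1)"
    by (intro prod.cong) auto
  then show ?thesis
    unfolding eq card_vec_Pi prod_if_card .
qed

lemma card_supp_eq:
  "card {x :: 'a::{zero,finite} ^ 'n::finite. {j. x $ j \<noteq> 0} = J} = (CARD('a) - 1) ^ card J"
proof -
  have eq: "{x :: 'a ^ 'n. {j. x $ j \<noteq> 0} = J} = {x. \<forall>j. x $ j \<in> (if j \<in> J then - {0} else {0})}"
    by (auto split: if_splits)
  have "(\<Prod>j\<in>UNIV. card (if j \<in> J then - {0} else {0::'a})) =
      (\<Prod>j\<in>UNIV. if j \<in> J then CARD('a) - 1 else 1)"
    by (intro prod.cong) (auto simp: Compl_eq_Diff_UNIV card_Diff_subset)
  then show ?thesis
    unfolding eq card_vec_Pi prod_if_card .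
qed

text \<open>The predicate \<open>P\<close> is \<open>card I = w\<close> when vectors are sorted by
  weight, and \<open>I \<subseteq> J\<close> when they are counted inside a given support for the
  Moebius inversion.\<close>

lemma card_by_support:
  "card {x \<in> S. P {j. x $ j \<noteq> 0}} =
    (\<Sum>I | P I. card {x \<in> (S :: ('a::{zero,finite} ^ 'n::finite) set). {j. x $ j \<noteq> 0} = I})"
proof -
  have "{x \<in> S. P {j. x $ j \<noteq> 0}} = (\<Union>I\<in>{I. P I}. {x \<in> S. {j. x $ j \<noteq> 0} = I})"
    by auto
  then show ?thesis
    by (simp add: card_UN_disjoint disjoint_iff)
qed

lemma card_weight_eq:
  "card {x :: 'a::{zero,finite} ^ 'n::finite. hamming_weight x = w} =
    (CARD('n) choose w) * (CARD('a) - 1) ^ w"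
proof -
  have "card {x :: 'a ^ 'n. hamming_weight x = w} =
      (\<Sum>I | card I = w. card {x :: 'a ^ 'n. {j. x $ j \<noteq> 0} = I})"
    using card_by_support[of UNIV "\<lambda>I. card I = w"] by (simp add: hamming_weight_def)
  also have "\<dots> = (\<Sum>I::'n set | card I = w. (CARD('a) - 1) ^ w)"
    by (simp add: card_supp_eq)
  also have "card {I :: 'n set. card I = w} = CARD('n) choose w"
    using n_subsets[of "UNIV :: 'n set" w] by simp
  then have "(\<Sum>I::'n set | card I = w. (CARD('a) - 1) ^ w) = (CARD('n) choose w) * (CARD('a) - 1) ^ w"
    by simp
  finally show ?thesis .
qed

text \<open>A superset of \<open>I\<close> is \<open>I\<close> together with a subset of its
  complement. Without the bound on \<open>card I\<close>, the subtraction \<open>w - card I\<close>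
  would truncate and the right side would be 1 although no such \<open>J\<close> exists.\<close>

lemma card_supersets:
  assumes "card (I :: 'n::finite set) \<le> w"
  shows "card {J. I \<subseteq> J \<and> card J = w} = (CARD('n) - card I) choose (w - card I)"
proof -
  have "bij_betw (\<lambda>K. K \<union> I) {K. K \<subseteq> - I \<and> card K = w - card I} {J. I \<subseteq> J \<and> card J = w}"
  proof (rule bij_betwI[where g = "\<lambda>J. J - I"])
    show "(\<lambda>K. K \<union> I) \<in> {K. K \<subseteq> - I \<and> card K = w - card I} \<rightarrow> {J. I \<subseteq> J \<and> card J = w}"
    proof (intro Pi_I CollectI conjI)
      fix K assume K: "K \<in> {K. K \<subseteq> - I \<and> card K = w - card I}"
      then have "card (K \<union> I) = card K + card I"
        by (intro card_Un_disjoint) auto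
      then show "card (K \<union> I) = w"
        using K assms by simp
    qed auto
    show "(\<lambda>J. J - I) \<in> {J. I \<subseteq> J \<and> card J = w} \<rightarrow> {K. K \<subseteq> - I \<and> card K = w - card I}"
      by (auto simp: card_Diff_subset)
  qed auto
  then have "card {J. I \<subseteq> J \<and> card J = w} = card {K. K \<subseteq> - I \<and> card K = w - card I}"
    by (simp add: bij_betw_same_card)
  also have "\<dots> = card (- I) choose (w - card I)"
    using n_subsets[of "- I" "w - card I"] by simp
  finally show ?thesis
    by (simp add: Compl_eq_Diff_UNIV card_Diff_subset)
qed

text \<open>Double counting of the pairs \<open>I \<subseteq> J\<close> with
  \<open>card J = w\<close>; the right side groups them by the size of \<open>I\<close>.\<close>

lemma sum_subsets_of_card:
  fixes f :: "'n::finite set \<Rightarrow> int"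
  shows "(\<Sum>J | card J = w. \<Sum>I\<in>Pow J. f I) =
    (\<Sum>k\<le>w. int ((CARD('n) - k) choose (w - k)) * (\<Sum>I | card I = k. f I))"
proof -
  have "(\<Sum>J | card J = w. \<Sum>I\<in>Pow J. f I) =
      (\<Sum>J\<in>{J. card J = w}. \<Sum>I | I \<in> {I. card I \<le> w} \<and> I \<subseteq> J. f I)"
    by (intro sum.cong) (auto simp: card_mono)
  also have "\<dots> = (\<Sum>I\<in>{I. card I \<le> w}. \<Sum>J | J \<in> {J. card J = w} \<and> I \<subseteq> J. f I)"
    by (rule sum.swap_restrict) auto
  also have "\<dots> = (\<Sum>I\<in>{I. card I \<le> w}. int ((CARD('n) - card I) choose (w - card I)) * f I)"
    by (intro sum.cong refl) (simp add: card_supersets conj_commute)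
  also have "\<dots> = (\<Sum>k\<in>{..w}. \<Sum>I\<in>{I \<in> {I. card I \<le> w}. card I = k}.
      int ((CARD('n) - card I) choose (w - card I)) * f I)"
    by (rule sum.group[symmetric]) auto
  also have "\<dots> = (\<Sum>k\<le>w. int ((CARD('n) - k) choose (w - k)) * (\<Sum>I | card I = k. f I))"
    by (auto simp: sum_distrib_left intro!: sum.cong)
  finally show ?thesis .
qed

lemma weight_count_by_support:
  "weight_count S w = (\<Sum>I | card I = w. int (card {x \<in> (S :: ('a::{zero,finite} ^ 'n::finite) set). {j. x $ j \<noteq> 0} = I}))"
  unfolding weight_count_def hamming_weight_def
  using card_by_support[of S "\<lambda>I. card I = w"] by simp

text \<open>A vector of weight \<open>k\<close> is counted once for each \<open>J\<close> of size
  \<open>w\<close> that contains its support.\<close>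

lemma sum_supported:
  "(\<Sum>J | card J = w. int (card {x \<in> S. {j. x $ j \<noteq> 0} \<subseteq> J})) =
    (\<Sum>k\<le>w. int ((CARD('n) - k) choose (w - k)) * weight_count (S :: ('a::{zero,finite} ^ 'n::finite) set) k)"
proof -
  have "int (card {x \<in> S. {j. x $ j \<noteq> 0} \<subseteq> J}) =
      (\<Sum>I\<in>Pow J. int (card {x \<in> S. {j. x $ j \<noteq> 0} = I}))" for J
    using card_by_support[of S "\<lambda>I. I \<subseteq> J"] by (simp add: Pow_def)
  then show ?thesis
    by (simp add: sum_subsets_of_card weight_count_by_support)
qed

lemma hamming_weight_le: "{j. x $ j \<noteq> 0} \<subseteq> J \<Longrightarrow> hamming_weight x \<le> card J"
  unfolding hamming_weight_def by (rule card_mono) auto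

lemma hamming_weight_diff_le:
  "hamming_weight (x - y) \<le> card ({j. x $ j \<noteq> 0} \<union> {j. (y :: 'a::ab_group_add ^ 'n::finite) $ j \<noteq> 0})"
  by (rule hamming_weight_le) auto

lemma hamming_weight_eq_0 [simp]: "hamming_weight x = 0 \<longleftrightarrow> x = 0"
  by (auto simp: hamming_weight_def vec_eq_iff)

lemma hamming_weight_zero [simp]: "hamming_weight 0 = 0"
  by simp

section \<open>Cosets of a code of minimum distance four\<close>

text \<open>\<open>fibre H 0\<close> is the code; the fibre over a syndrome \<open>s\<close> is one
  of its cosets as soon as it is nonempty.\<close>

definition fibre :: "'a::field ^ 'n ^ 'm \<Rightarrow> 'a ^ 'm \<Rightarrow> ('a ^ 'n) set" where
  "fibre H s = {x. H *v x = s}"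

lemma fibre_eq_iff: "fibre H s \<noteq> {} \<Longrightarrow> fibre H s = fibre H t \<longleftrightarrow> s = t"
  by (auto simp: fibre_def)

text \<open>\<open>min_weight\<close> expresses through codewords that any three columns of
  \<open>H\<close> are linearly independent.\<close>

locale parity_check_4 =
  fixes H :: "'a::{field,finite} ^ 'n::finite ^ 3"
  assumes n_ge_3: "3 \<le> CARD('n)"
    and min_weight: "x \<in> fibre H 0 \<Longrightarrow> x \<noteq> 0 \<Longrightarrow> 4 \<le> hamming_weight x"
begin

text \<open>\<open>x - y\<close> is a codeword supported in the union of the two supports, and a
  codeword of weight at most three is zero.\<close>

lemma fibre_unique:
  assumes "x \<in> fibre H s" "y \<in> fibre H s" "card ({j. x $ j \<noteq> 0} \<union> {j. y $ j \<noteq> 0}) \<le> 3"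
  shows "x = y"
proof (rule ccontr)
  assume "x \<noteq> y"
  moreover have "x - y \<in> fibre H 0"
    using assms(1,2) by (simp add: fibre_def matrix_vector_mult_diff_distrib)
  ultimately show False
    using min_weight[of "x - y"] hamming_weight_diff_le[of x y] assms(3) by simp
qed

lemma fibre_unique':
  assumes "x \<in> fibre H s" "y \<in> fibre H s" "hamming_weight x + hamming_weight y \<le> 3"
  shows "x = y"
proof (rule fibre_unique[OF assms(1,2)])
  show "card ({j. x $ j \<noteq> 0} \<union> {j. y $ j \<noteq> 0}) \<le> 3"
    using assms(3) card_Un_le[of "{j. x $ j \<noteq> 0}" "{j. y $ j \<noteq> 0}"]
    unfolding hamming_weight_def by linarith
qed

text \<open>On three coordinates \<open>H\<close> is injective by \<open>fibre_unique\<close>, and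
  there are as many vectors supported there as syndromes, so every syndrome is attained.\<close>

lemma ex_supported_solution:
  assumes "3 \<le> card J"
  shows "\<exists>x\<in>fibre H s. {j. x $ j \<noteq> 0} \<subseteq> J"
proof -
  obtain K where K: "K \<subseteq> J" "card K = 3"
    using assms by (meson obtain_subset_with_card_n)
  let ?X = "{x :: 'a ^ 'n. {j. x $ j \<noteq> 0} \<subseteq> K}"
  have "inj_on (\<lambda>x. H *v x) ?X"
  proof (rule inj_onI)
    fix x y assume "x \<in> ?X" "y \<in> ?X" "H *v x = H *v y"
    then show "x = y"
      using K card_mono[of K "{j. x $ j \<noteq> 0} \<union> {j. y $ j \<noteq> 0}"]
      by (intro fibre_unique[of x "H *v x"]) (auto simp: fibre_def)
  qed
  then have "card ((\<lambda>x. H *v x) ` ?X) = CARD('a ^ 3)"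
    using K by (simp add: card_image card_supp_subset)
  then have "(\<lambda>x. H *v x) ` ?X = UNIV"
    by (intro card_subset_eq) auto
  then show ?thesis
  proof -
    have "s \<in> (\<lambda>x. H *v x) ` ?X"
      using \<open>(\<lambda>x. H *v x) ` ?X = UNIV\<close> by simp
    then show ?thesis
      using K by (auto simp: fibre_def)
  qed
qed

text \<open>Translation by one solution supported in \<open>J\<close> maps the codewords supported
  in \<open>J\<close> bijectively to the solutions supported in \<open>J\<close>.\<close>

lemma card_supported_fibre:
  assumes "3 \<le> card J"
  shows "card {x \<in> fibre H s. {j. x $ j \<noteq> 0} \<subseteq> J} = card {x \<in> fibre H 0. {j. x $ j \<noteq> 0} \<subseteq> J}"
proof -
  obtain z where z: "z \<in> fibre H s" "{j. z $ j \<noteq> 0} \<subseteq> J"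
    using ex_supported_solution[OF assms] by blast
  have "bij_betw (\<lambda>x. x + z) {x \<in> fibre H 0. {j. x $ j \<noteq> 0} \<subseteq> J} {x \<in> fibre H s. {j. x $ j \<noteq> 0} \<subseteq> J}"
  proof (rule bij_betwI[where g = "\<lambda>x. x - z"])
    show "(\<lambda>x. x - z) \<in> {x \<in> fibre H s. {j. x $ j \<noteq> 0} \<subseteq> J} \<rightarrow> {x \<in> fibre H 0. {j. x $ j \<noteq> 0} \<subseteq> J}"
      using z by (auto simp: fibre_def matrix_vector_mult_diff_distrib subset_iff) metis
    show "(\<lambda>x. x + z) \<in> {x \<in> fibre H 0. {j. x $ j \<noteq> 0} \<subseteq> J} \<rightarrow> {x \<in> fibre H s. {j. x $ j \<noteq> 0} \<subseteq> J}"
      using z by (auto simp: fibre_def matrix_vector_right_distrib subset_iff) (metis add_0)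
  qed auto
  then show ?thesis
    by (simp add: bij_betw_same_card)
qed

lemma weight_count_fibre_0:
  "weight_count (fibre H 0) 0 = 1"
  "0 < w \<Longrightarrow> w \<le> 3 \<Longrightarrow> weight_count (fibre H 0) w = 0"
proof -
  have "{x \<in> fibre H 0. hamming_weight x = 0} = {0}"
    by (auto simp: fibre_def)
  then show "weight_count (fibre H 0) 0 = 1"
    by (simp add: weight_count_def)
  have "{x \<in> fibre H 0. hamming_weight x = w} = {}" if "0 < w" "w \<le> 3"
  proof -
    have "hamming_weight x \<noteq> w" if "x \<in> fibre H 0" for x
      using min_weight[OF that] \<open>0 < w\<close> \<open>w \<le> 3\<close> by (cases "x = 0") auto
    then show ?thesis
      by blast
  qed
  then show "0 < w \<Longrightarrow> w \<le> 3 \<Longrightarrow> weight_count (fibre H 0) w = 0"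
    by (simp add: weight_count_def)
qed

lemma weight_count_0_fibre: "s \<noteq> 0 \<Longrightarrow> weight_count (fibre H s) 0 = 0"
  by (auto simp: weight_count_def fibre_def)

text \<open>By Moebius inversion over supports only the supports of size at most two contribute.\<close>

lemma weight_count_diff:
  assumes "2 \<le> w"
  shows "weight_count (fibre H s) w - weight_count (fibre H 0) w =
    (-1) ^ w * (\<Sum>k\<le>2. (-1) ^ k * int ((CARD('n) - k) choose (w - k)) *
      (\<Sum>l\<le>k. int ((CARD('n) - l) choose (k - l)) *
        (weight_count (fibre H s) l - weight_count (fibre H 0) l)))"
proof -
  \<comment> \<open>\<open>E\<close> counts vectors with exactly the given support and
    \<open>N\<close> those supported inside it, each as an excess over the code.\<close>
  define E where "E I = int (card {x \<in> fibre H s. {j. x $ j \<noteq> 0} = I}) -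
    int (card {x \<in> fibre H 0. {j. x $ j \<noteq> 0} = I})" for I
  define N where "N J = int (card {x \<in> fibre H s. {j. x $ j \<noteq> 0} \<subseteq> J}) -
    int (card {x \<in> fibre H 0. {j. x $ j \<noteq> 0} \<subseteq> J})" for J
  have N_E: "N J = sum E (Pow J)" for J
    unfolding N_def E_def card_by_support[of _ "\<lambda>I. I \<subseteq> J"]
    by (simp add: Pow_def sum_subtractf)
  have E_N: "E J = (\<Sum>I\<in>Pow J. (-1) ^ (card J - card I) * N I)" for J
    by (rule inclusion_exclusion_mobius) (auto simp: N_E)
  \<comment> \<open>\<open>card J - card I\<close> and \<open>card J + card I\<close> have the same
    parity, so the sign splits and the factor in \<open>card J\<close> leaves the sum.\<close>
  have E_N': "E J = (-1) ^ card J * (\<Sum>I\<in>Pow J. (-1) ^ card I * N I)" for J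
  proof -
    have "(-1) ^ (card J - card I) * N I = (-1) ^ card J * ((-1) ^ card I * N I)" if "I \<subseteq> J" for I
    proof -
      have "(-1 :: int) ^ (card J - card I) = (-1) ^ (card J + card I)"
        using that by (intro neg_one_power_add_eq_neg_one_power_diff[symmetric] card_mono) auto
      then show ?thesis
        by (simp add: power_add)
    qed
    then show ?thesis
      unfolding E_N sum_distrib_left by (intro sum.cong) auto
  qed
  have sum_N: "(\<Sum>J | card J = k. N J) = (\<Sum>l\<le>k. int ((CARD('n) - l) choose (k - l)) *
      (weight_count (fibre H s) l - weight_count (fibre H 0) l))" for k
    unfolding N_def sum_subtractf sum_supported by (simp add: sum_subtractf algebra_simps)
  have N_0: "(\<Sum>J | card J = k. N J) = 0" if "3 \<le> k" for k
  proof (rule sum.neutral, rule ballI)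
    fix J :: "'n set" assume "J \<in> {J. card J = k}"
    then show "N J = 0"
      using that card_supported_fibre[of J s] by (simp add: N_def)
  qed
  have "weight_count (fibre H s) w - weight_count (fibre H 0) w = (\<Sum>J | card J = w. E J)"
    by (simp add: weight_count_by_support E_def sum_subtractf)
  also have "\<dots> = (-1) ^ w * (\<Sum>J | card J = w. \<Sum>I\<in>Pow J. (-1) ^ card I * N I)"
    by (simp add: E_N' sum_distrib_left)
  also have "\<dots> = (-1) ^ w * (\<Sum>k\<le>w. int ((CARD('n) - k) choose (w - k)) *
      (\<Sum>J | card J = k. (-1) ^ card J * N J))"
    by (simp only: sum_subsets_of_card)
  also have "(\<Sum>k\<le>w. int ((CARD('n) - k) choose (w - k)) * (\<Sum>J | card J = k. (-1) ^ card J * N J)) =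
      (\<Sum>k\<le>w. (-1) ^ k * int ((CARD('n) - k) choose (w - k)) * (\<Sum>J | card J = k. N J))"
    by (intro sum.cong refl) (simp add: mult_ac flip: sum_distrib_left sum_distrib_right)
  \<comment> \<open>\<open>N_0\<close> kills the terms with \<open>k \<ge> 3\<close>, and
    \<open>2 \<le> w\<close> makes \<open>{..2}\<close> part of the range.\<close>
  also have "\<dots> = (\<Sum>k\<le>2. (-1) ^ k * int ((CARD('n) - k) choose (w - k)) * (\<Sum>J | card J = k. N J))"
    using assms N_0 by (intro sum.mono_neutral_right) auto
  finally show ?thesis
    unfolding sum_N .
qed

text \<open>The sum of \<open>weight_count_diff\<close> in closed form, using A_0 = 1, A_1 = A_2 = 0
  and B_0 = 0. \<open>D1\<close>, \<open>D2\<close> and \<open>D3\<close> arise from it by inserting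
  the possible values of B_1 and B_2.\<close>

lemma weight_count_fibre:
  assumes "s \<noteq> 0" "2 \<le> w" "w \<le> CARD('n)"
  shows "weight_count (fibre H s) w = weight_count (fibre H 0) w - Omega CARD('n) 0 w
    + Omega CARD('n) 1 w * weight_count (fibre H s) 1
    + (-1) ^ w * int ((CARD('n) - 2) choose (CARD('n) - w)) * weight_count (fibre H s) 2"
proof -
  obtain k where w: "w = k + 2"
    using assms(2) by (metis add.commute le_Suc_ex)
  obtain m where n: "CARD('n) = m + 2"
    using assms by (metis add.commute le_Suc_ex le_trans)
  \<comment> \<open>The binomials \<open>(n - v) choose (w - v)\<close> for
    \<open>v = 0, 1, 2\<close>. Absorption links neighbouring ones, which reduces the claim to
    polynomial algebra.\<close>
  define X Y Z where XYZ: "X = int ((m + 2) choose (k + 2))" "Y = int ((m + 1) choose (k + 1))"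
    "Z = int (m choose k)"
  have "(k + 2) * ((m + 2) choose (k + 2)) = (m + 2) * ((m + 1) choose (k + 1))"
    using Suc_times_binomial[of "k + 1" "m + 1"] by (simp del: binomial_Suc_Suc)
  then have XY: "(int k + 2) * X = (int m + 2) * Y"
    unfolding XYZ by (metis of_nat_add of_nat_mult of_nat_numeral)
  have "(k + 1) * ((m + 1) choose (k + 1)) = (m + 1) * (m choose k)"
    using Suc_times_binomial[of k m] by (simp del: binomial_Suc_Suc)
  then have YZ: "(int k + 1) * Y = (int m + 1) * Z"
    unfolding XYZ by (metis of_nat_add of_nat_mult of_nat_1)
  have "2 * (Suc (Suc m) choose 2) = (m + 2) * (m + 1)"
    using Suc_times_binomial[of 1 "Suc m"] by (simp add: numeral_2_eq_2 del: binomial_Suc_Suc)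
  then have choose: "2 * int (Suc (Suc m) choose 2) = (int m + 2) * (int m + 1)"
    by (metis of_nat_add of_nat_mult of_nat_numeral of_nat_1)
  have mk: "m choose (m - k) = m choose k"
    using assms(3) n w by (intro binomial_symmetric[symmetric]) simp
  have choose': "2 * int (Suc k choose 2) = (int k + 1) * int k"
  proof (cases k)
    case (Suc l)
    have "2 * (Suc (Suc l) choose 2) = (l + 2) * (l + 1)"
      using Suc_times_binomial[of 1 "Suc l"] by (simp add: numeral_2_eq_2 del: binomial_Suc_Suc)
    then have "2 * int (Suc (Suc l) choose 2) = (int l + 2) * (int l + 1)"
      by (metis of_nat_add of_nat_mult of_nat_numeral of_nat_1)
    then show ?thesis
      by (simp add: Suc algebra_simps)
  qed simp
  define b where "b = weight_count (fibre H s)"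
  have "b w - weight_count (fibre H 0) w = (-1) ^ w * (- X - Y * (b 1 - (int m + 2)) +
      Z * ((int m + 1) * b 1 + b 2 - int (Suc (Suc m) choose 2)))"
    unfolding weight_count_diff[OF assms(2)] n b_def
    using assms(1) by (simp add: numeral_2_eq_2 weight_count_0_fibre weight_count_fibre_0 w XYZ algebra_simps del: binomial_Suc_Suc)
  \<comment> \<open>\<open>YZ\<close> turns the coefficient of \<open>b 1\<close> into
    \<open>Y * k\<close>. By \<open>XY\<close> and \<open>YZ\<close> the constant term is
    \<open>X\<close> times \<open>- 1 + (k + 2) - (k + 1) * (k + 2) / 2\<close>, that is
    \<open>- k * (k + 1) / 2\<close>.\<close>
  also have "- X - Y * (b 1 - (int m + 2)) + Z * ((int m + 1) * b 1 + b 2 - int (Suc (Suc m) choose 2)) =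
      - X * int (Suc k choose 2) + Y * int k * b 1 + Z * b 2"
    using XY YZ choose choose' by algebra
  finally have "b w = weight_count (fibre H 0) w +
      (-1) ^ w * (- X * int (Suc k choose 2) + Y * int k * b 1 + Z * b 2)"
    by linarith
  moreover have "Omega (m + 2) 0 w = (-1) ^ w * X * int (Suc k choose 2)"
    "Omega (m + 2) 1 w = (-1) ^ w * Y * int k"
    by (simp_all add: Omega_def w XYZ del: binomial_Suc_Suc)
  moreover have "(m + 2 - 2) choose (m + 2 - w) = m choose k"
    using mk by (simp add: w)
  ultimately show ?thesis
    unfolding n b_def[symmetric] XYZ(3) by (simp add: algebra_simps)
qed

section \<open>Cosets as fibres of the syndrome map, and their weights\<close>

lemma ex_weight_le_3: "\<exists>x\<in>fibre H s. hamming_weight x \<le> 3"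
proof -
  obtain J :: "'n set" where "card J = 3"
    using n_ge_3 obtain_subset_with_card_n[of 3 UNIV] by auto
  then show ?thesis
    using ex_supported_solution[of J s] hamming_weight_le[of _ J] by auto
qed

lemma fibre_nonempty: "fibre H s \<noteq> {}"
  using ex_weight_le_3 by blast

lemma inj_fibre: "inj (fibre H)"
  by (rule injI) (simp add: fibre_eq_iff[OF fibre_nonempty])

lemma cosets_eq: "cosets (fibre H 0) = range (fibre H)"
proof -
  have coset: "(\<lambda>c. c + v) ` fibre H 0 = fibre H (H *v v)" for v
  proof (intro equalityI subsetI)
    fix x assume "x \<in> fibre H (H *v v)"
    then have "x - v \<in> fibre H 0"
      by (simp add: fibre_def matrix_vector_mult_diff_distrib)
    then show "x \<in> (\<lambda>c. c + v) ` fibre H 0"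
      by (intro image_eqI[of _ _ "x - v"]) auto
  qed (auto simp: fibre_def matrix_vector_right_distrib)
  have "\<exists>v. H *v v = s" for s
    using fibre_nonempty[of s] by (auto simp: fibre_def)
  then show ?thesis
    unfolding cosets_def coset by (auto simp: image_iff) metis
qed

text \<open>A lighter vector and the given one would have total weight at most three and so coincide
  by \<open>fibre_unique'\<close>. Weight three is excluded because cosets of smaller weight may
  also contain vectors of weight three.\<close>

lemma coset_weight_fibre_iff:
  assumes "w \<le> 2"
  shows "coset_weight (fibre H s) = w \<longleftrightarrow> (\<exists>x\<in>fibre H s. hamming_weight x = w)"
proof
  assume "coset_weight (fibre H s) = w"
  then show "\<exists>x\<in>fibre H s. hamming_weight x = w"
    unfolding coset_weight_def using fibre_nonempty[of s]
      LeastI_ex[of "\<lambda>w. \<exists>x\<in>fibre H s. hamming_weight x = w"] by blast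
next
  assume "\<exists>x\<in>fibre H s. hamming_weight x = w"
  then obtain x where x: "x \<in> fibre H s" "hamming_weight x = w"
    by blast
  show "coset_weight (fibre H s) = w"
    unfolding coset_weight_def
  proof (rule Least_equality)
    fix v assume "\<exists>y\<in>fibre H s. hamming_weight y = v"
    then obtain y where y: "y \<in> fibre H s" "hamming_weight y = v"
      by blast
    show "w \<le> v"
    proof (rule ccontr)
      assume "\<not> w \<le> v"
      then have "x = y"
        using x y assms by (intro fibre_unique'[of x s]) auto
      then show False
        using x y \<open>\<not> w \<le> v\<close> by simp
    qed
  qed (use x in blast)
qed

lemma coset_weight_fibre_le: "x \<in> fibre H s \<Longrightarrow> coset_weight (fibre H s) \<le> hamming_weight x"
  unfolding coset_weight_def by (rule Least_le) blast

lemma coset_weight_fibre_le_3: "coset_weight (fibre H s) \<le> 3"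
  using ex_weight_le_3[of s] coset_weight_fibre_le le_trans by blast

lemma coset_weight_fibre_0_iff: "coset_weight (fibre H s) = 0 \<longleftrightarrow> s = 0"
  by (simp add: coset_weight_fibre_iff) (auto simp: fibre_def)

text \<open>Counting is done on syndromes; \<open>inj_fibre\<close> carries the cardinalities over
  to cosets.\<close>

definition syndromes :: "nat \<Rightarrow> ('a ^ 3) set" where
  "syndromes w = {s. coset_weight (fibre H s) = w}"

lemma cosets_of_weight_eq: "cosets_of_weight (fibre H 0) w = fibre H ` syndromes w"
  unfolding cosets_of_weight_def cosets_eq syndromes_def by auto

lemma card_image_fibre: "card (fibre H ` A) = card A"
  by (meson card_image inj_fibre inj_on_subset subset_UNIV)

lemma card_weight_1_le: "card {x \<in> fibre H s. hamming_weight x = 1} \<le> 1"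
  by (auto simp: card_le_Suc0_iff_eq intro: fibre_unique')

lemma weight_count_1:
  "weight_count (fibre H s) 1 = (if coset_weight (fibre H s) = 1 then 1 else 0)"
proof (cases "coset_weight (fibre H s) = 1")
  case True
  then have "{x \<in> fibre H s. hamming_weight x = 1} \<noteq> {}"
    by (auto simp: coset_weight_fibre_iff)
  then have "card {x \<in> fibre H s. hamming_weight x = 1} > 0"
    by (simp add: card_gt_0_iff)
  then show ?thesis
    using True card_weight_1_le[of s] by (simp add: weight_count_def)
next
  case False
  then have "{x \<in> fibre H s. hamming_weight x = 1} = {}"
    by (auto simp: coset_weight_fibre_iff)
  then show ?thesis
    using False by (simp add: weight_count_def)
qed

lemma weight_count_2_eq_0:
  assumes "coset_weight (fibre H s) \<noteq> 2"
  shows "weight_count (fibre H s) 2 = 0"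
proof -
  have "{x \<in> fibre H s. hamming_weight x = 2} = {}"
    using assms by (auto simp: coset_weight_fibre_iff)
  then show ?thesis
    by (simp add: weight_count_def)
qed

section \<open>Weight distributions of the cosets of weight one, two and three\<close>

text \<open>The value at \<open>w = 3\<close> comes from the general formula:
  \<open>Omega n 0 3\<close> and \<open>Omega n 1 3\<close> are the negatives of
  \<open>n choose 3\<close> and \<open>(n - 1) choose 2\<close>, and Pascal's rule applies.\<close>

lemma D1_fibre:
  assumes "s \<in> syndromes 1"
  shows "D1 (fibre H 0) (fibre H s)"
proof -
  have s: "coset_weight (fibre H s) = 1" "s \<noteq> 0"
    using assms coset_weight_fibre_0_iff[of s] by (auto simp: syndromes_def)
  have B: "weight_count (fibre H s) 0 = 0" "weight_count (fibre H s) 1 = 1"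
      "weight_count (fibre H s) 2 = 0"
    using s by (simp_all add: weight_count_0_fibre weight_count_1[unfolded One_nat_def] weight_count_2_eq_0)
  have formula: "weight_count (fibre H s) w = weight_count (fibre H 0) w - Omega CARD('n) 0 w + Omega CARD('n) 1 w"
    if "2 \<le> w" "w \<le> CARD('n)" for w
    using weight_count_fibre[OF s(2) that] B by simp
  obtain m where n: "CARD('n) = Suc m"
    using n_ge_3 by (metis Suc_le_D numeral_3_eq_3)
  then have choose: "CARD('n) choose 3 = ((CARD('n) - 1) choose 3) + ((CARD('n) - 1) choose 2)"
    by (simp add: numeral_3_eq_3 numeral_2_eq_2)
  have "weight_count (fibre H s) 3 = int ((CARD('n) - 1) choose 3)"
    using formula[of 3] n_ge_3 weight_count_fibre_0(2)[of 3] choose by (simp add: Omega_def)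
  then show ?thesis
    unfolding D1_def Let_def using B formula by simp
qed

lemma D2_fibre:
  assumes "s \<in> syndromes 2"
  shows "D2 (fibre H 0) (card {x \<in> fibre H s. hamming_weight x = 2}) (fibre H s)"
proof -
  have s: "coset_weight (fibre H s) = 2" "s \<noteq> 0"
    using assms coset_weight_fibre_0_iff[of s] by (auto simp: syndromes_def)
  then show ?thesis
    unfolding D2_def Let_def
  proof (intro conjI ballI)
    have B1: "weight_count (fibre H s) 1 = 0"
      using s by (simp add: weight_count_1[unfolded One_nat_def])
    have B2: "weight_count (fibre H s) 2 = int (card {x \<in> fibre H s. hamming_weight x = 2})"
      by (simp add: weight_count_def)
    show "weight_count (fibre H s) w = weight_count (fibre H 0) w - Omega CARD('n) 0 w +
        (- 1) ^ w * int ((CARD('n) - 2) choose (CARD('n) - w)) *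
        int (card {x \<in> fibre H s. hamming_weight x = 2})" if "w \<in> {3..CARD('n)}" for w
      using weight_count_fibre[OF s(2), of w] that unfolding B1 B2 by simp
  qed (use s in \<open>simp_all add: weight_count_0_fibre weight_count_1[unfolded One_nat_def], simp add: weight_count_def\<close>)
qed

lemma D3_fibre:
  assumes "s \<in> syndromes 3"
  shows "D3 (fibre H 0) (fibre H s)"
proof -
  have s: "coset_weight (fibre H s) = 3" "s \<noteq> 0"
    using assms coset_weight_fibre_0_iff[of s] by (auto simp: syndromes_def)
  have B: "weight_count (fibre H s) 0 = 0" "weight_count (fibre H s) 1 = 0"
      "weight_count (fibre H s) 2 = 0"
    using s by (simp_all add: weight_count_0_fibre weight_count_1[unfolded One_nat_def] weight_count_2_eq_0)
  have formula: "weight_count (fibre H s) w = weight_count (fibre H 0) w - Omega CARD('n) 0 w"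
    if "2 \<le> w" "w \<le> CARD('n)" for w
    using weight_count_fibre[OF s(2) that] B by simp
  have "weight_count (fibre H s) 3 = int (CARD('n) choose 3)"
    using formula[of 3] n_ge_3 weight_count_fibre_0(2)[of 3] by (simp add: Omega_def)
  then show ?thesis
    unfolding D3_def Let_def using B formula by simp
qed

text \<open>The terms of \<open>weight_count_fibre\<close> involving B_2 have the same binomial at
  \<open>w\<close> and at \<open>n + 2 - w\<close>, and after the factor \<open>(- 1) ^ n\<close>
  the same sign. They cancel, and only quantities of the code remain.\<close>

lemma reflected_weight_count:
  assumes "s \<in> syndromes 2" "t \<in> syndromes 2" "w \<in> {3..CARD('n)}"
  shows "(- 1) ^ CARD('n) * weight_count (fibre H s) w - weight_count (fibre H s) (CARD('n) + 2 - w) =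
    (- 1) ^ CARD('n) * weight_count (fibre H t) w - weight_count (fibre H t) (CARD('n) + 2 - w)"
proof -
  let ?n = "CARD('n)"
  obtain k where w: "w = k + 2" and k: "k + 2 \<le> ?n"
    using assms(3) that[of "w - 2"] by auto
  obtain m where n: "?n = m + k + 2"
    using k that[of "?n - k - 2"] by linarith
  \<comment> \<open>The range starts at 2 because \<open>w = n\<close> is reflected to 2, outside
    the range of the formula in \<open>D2\<close>.\<close>
  have B: "weight_count (fibre H r) v = weight_count (fibre H 0) v - Omega ?n 0 v +
      (-1) ^ v * int ((?n - 2) choose (?n - v)) * weight_count (fibre H r) 2"
    if "r \<in> syndromes 2" "2 \<le> v" "v \<le> ?n" for r v
  proof -
    have "coset_weight (fibre H r) = 2" "r \<noteq> 0"
      using that coset_weight_fibre_0_iff[of r] by (auto simp: syndromes_def)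
    then show ?thesis
      using weight_count_fibre[of r v] that by (simp add: weight_count_1[unfolded One_nat_def])
  qed
  have choose: "(m + k) choose k = (m + k) choose m"
    using binomial_symmetric[of k "m + k"] by simp
  have "(-1) ^ ?n * weight_count (fibre H r) w - weight_count (fibre H r) (?n + 2 - w) =
      (-1) ^ ?n * (weight_count (fibre H 0) w - Omega ?n 0 w) -
      (weight_count (fibre H 0) (?n + 2 - w) - Omega ?n 0 (?n + 2 - w))"
    if "r \<in> syndromes 2" for r
  proof -
    define z where "z = int ((m + k) choose m) * weight_count (fibre H r) 2"
    have "weight_count (fibre H r) w = weight_count (fibre H 0) w - Omega ?n 0 w + (-1) ^ k * z"
      using B[OF that, of w] by (simp add: n w z_def choose)
    moreover have "weight_count (fibre H r) (?n + 2 - w) =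
        weight_count (fibre H 0) (?n + 2 - w) - Omega ?n 0 (?n + 2 - w) + (-1) ^ m * z"
      using B[OF that, of "?n + 2 - w"] by (simp add: n w z_def choose)
    moreover have "(-1 :: int) ^ k * (-1) ^ k = 1"
      by (simp flip: power_add)
    moreover have "(-1 :: int) ^ ?n = (-1) ^ m * (-1) ^ k"
      by (simp add: n power_add)
    moreover have "N * W - V = N * c - d"
      if "W = c + e * z" "V = d + f * z" "e * e = 1" "N = f * e" for N W V c d e f :: int
      using that by algebra
    ultimately show ?thesis
      by blast
  qed
  then show ?thesis
    using assms by simp
qed

text \<open>The distance from \<open>v\<close> to the code is the weight of the coset of
  \<open>v\<close>. Three always suffices, and a coset of weight three shows that it is
  attained.\<close>

lemma covering_radius_fibre:
  assumes "syndromes 3 \<noteq> {}"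
  shows "covering_radius (fibre H 0) = 3"
  unfolding covering_radius_def
proof (rule Least_equality)
  have dist: "hamming_dist v c = hamming_weight (v - c)" for v c :: "'a ^ 'n"
    by (simp add: hamming_dist_def hamming_weight_def)
  show "\<forall>v. \<exists>c\<in>fibre H 0. hamming_dist v c \<le> 3"
  proof
    fix v
    obtain y where "y \<in> fibre H (H *v v)" "hamming_weight y \<le> 3"
      using ex_weight_le_3 by blast
    then show "\<exists>c\<in>fibre H 0. hamming_dist v c \<le> 3"
      by (intro bexI[of _ "v - y"]) (auto simp: dist fibre_def matrix_vector_mult_diff_distrib)
  qed
  fix R assume R: "\<forall>v. \<exists>c\<in>fibre H 0. hamming_dist v c \<le> R"
  obtain s v where s: "s \<in> syndromes 3" "v \<in> fibre H s"
    using assms fibre_nonempty by blast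
  obtain c where c: "c \<in> fibre H 0" "hamming_weight (v - c) \<le> R"
    using R by (auto simp: dist)
  then have "v - c \<in> fibre H s"
    using s by (auto simp: fibre_def matrix_vector_mult_diff_distrib)
  then show "3 \<le> R"
    using s c coset_weight_fibre_le[of "v - c" s] by (simp add: syndromes_def)
qed

section \<open>Counting syndromes by coset weight\<close>

text \<open>Vectors of weight at most one are determined by their syndrome. For weight two this can
  fail, and the weighted count \<open>sum_card_weight_2\<close> takes its place.\<close>

lemma card_syndromes:
  assumes "w \<le> 1"
  shows "card (syndromes w) = (CARD('n) choose w) * (CARD('a) - 1) ^ w"
proof -
  have "syndromes w = (\<lambda>x. H *v x) ` {x. hamming_weight x = w}"
    using assms by (auto simp: syndromes_def coset_weight_fibre_iff) (auto simp: fibre_def)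
  moreover have "inj_on ((\<lambda>x. H *v x)) {x. hamming_weight x = w}"
    using assms by (auto intro!: inj_onI fibre_unique'[of _ "H *v _"] simp: fibre_def)
  ultimately show ?thesis
    by (simp add: card_image card_weight_eq)
qed

lemma sum_card_syndromes:
  "card (syndromes 0) + card (syndromes 1) + card (syndromes 2) + card (syndromes 3) = CARD('a) ^ 3"
proof -
  have "(UNIV :: ('a ^ 3) set) = (\<Union>w\<in>{..3}. syndromes w)"
    using coset_weight_fibre_le_3 by (auto simp: syndromes_def)
  then have "CARD('a ^ 3) = card (\<Union>w\<in>{..3}. syndromes w)"
    by simp
  also have "\<dots> = (\<Sum>w\<le>3. card (syndromes w))"
    by (rule card_UN_disjoint) (auto simp: syndromes_def)
  finally show ?thesis
    by (simp add: numeral_3_eq_3 numeral_2_eq_2)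
qed

text \<open>By \<open>coset_weight_fibre_iff\<close> each vector of weight two lies in a coset of
  weight exactly two, so these fibres partition such vectors.\<close>

lemma sum_card_weight_2:
  "(\<Sum>s\<in>syndromes 2. card {x \<in> fibre H s. hamming_weight x = 2}) =
    (CARD('n) choose 2) * (CARD('a) - 1) ^ 2"
proof -
  have "{x. hamming_weight x = 2} = (\<Union>s\<in>syndromes 2. {x \<in> fibre H s. hamming_weight x = 2})"
    by (auto simp: syndromes_def coset_weight_fibre_iff) (auto simp: fibre_def)
  then have "card {x :: 'a ^ 'n. hamming_weight x = 2} =
      (\<Sum>s\<in>syndromes 2. card {x \<in> fibre H s. hamming_weight x = 2})"
    by (simp only:) (rule card_UN_disjoint, auto simp: fibre_def)
  then show ?thesis
    by (simp add: card_weight_eq)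
qed

end

section \<open>The conic\<close>

definition conic_form :: "'a::field ^ 3 \<Rightarrow> 'a" where
  "conic_form s = (s $ 2) ^ 2 - s $ 1 * s $ 3"

text \<open>The polar form of \<open>conic_form\<close>. In every characteristic,
  \<open>conic_polar s (conic_point i) = 0\<close> says that the tangent at point \<open>i\<close>
  passes through \<open>s\<close>.\<close>

definition conic_polar :: "'a::field ^ 3 \<Rightarrow> 'a ^ 3 \<Rightarrow> 'a" where
  "conic_polar s t = 2 * s $ 2 * t $ 2 - s $ 1 * t $ 3 - s $ 3 * t $ 1"

lemma conic_polar_add: "conic_polar (x + y) z = conic_polar x z + conic_polar y z"
  by (simp add: conic_polar_def algebra_simps)

lemma conic_polar_scale: "conic_polar (a *s x) z = a * conic_polar x z"
  by (simp add: conic_polar_def algebra_simps)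

lemma conic_polar_scale_right: "conic_polar x (a *s z) = a * conic_polar x z"
  by (simp add: conic_polar_def algebra_simps)

lemma conic_polar_commute: "conic_polar x y = conic_polar y x"
  by (simp add: conic_polar_def algebra_simps)

lemma conic_form_add:
  "conic_form (x + y) = conic_form x + conic_polar x y + conic_form y"
  by (simp add: conic_form_def conic_polar_def power2_eq_square algebra_simps)

lemma conic_form_scale: "conic_form (a *s x) = a ^ 2 * conic_form x"
  by (simp add: conic_form_def power2_eq_square algebra_simps)

lemma conic_form_point [simp]: "conic_form (conic_point i) = 0"
  by (cases i) (simp_all add: conic_form_def)

text \<open>For affine points the value is \<open>- ((t - u) ^ 2)\<close>, so a tangent meets the
  conic only at its point of contact, also in characteristic two.\<close>

lemma conic_polar_point_eq_0 [simp]: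
  "conic_polar (conic_point i) (conic_point j) = 0 \<longleftrightarrow> i = j"
proof (cases i; cases j)
  fix t u assume [simp]: "i = Some t" "j = Some u"
  have "conic_polar (conic_point i) (conic_point j) = - ((t - u) ^ 2)"
    by (simp add: conic_polar_def power2_eq_square algebra_simps)
  then show ?thesis
    by simp
qed (simp_all add: conic_polar_def)

lemma conic_polar_self [simp]: "conic_polar (conic_point i) (conic_point i) = 0"
  by simp

lemma conic_polar_point_Some: "conic_polar s (conic_point (Some t)) = 2 * s $ 2 * t - s $ 1 * t ^ 2 - s $ 3"
  and conic_polar_point_None: "conic_polar s (conic_point None) = - s $ 1"
  by (simp_all add: conic_polar_def)

lemma conic_point_nonzero [simp]: "conic_point i \<noteq> 0"
  by (cases i) (simp_all add: vec_eq_iff forall_3)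

text \<open>Pairing both sides with point \<open>j\<close> kills the right side, which forces
  \<open>i = j\<close>.\<close>

lemma scaled_conic_point_eq:
  assumes "a *s conic_point i = b *s conic_point j" "a \<noteq> 0"
  shows "i = j" "a = b"
proof -
  have "a * conic_polar (conic_point i) (conic_point j) = b * conic_polar (conic_point j) (conic_point j)"
    using assms(1) by (metis conic_polar_scale)
  then show "i = j"
    using assms(2) by simp
  then show "a = b"
    using assms(1) by (simp add: vec.scale_right_imp_eq)
qed

lemma conic_form_eq_0:
  assumes "conic_form s = 0"
  shows "\<exists>b i. s = b *s conic_point i"
proof (cases "s $ 1 = 0")
  case True
  then have "s = (s $ 3) *s conic_point None"
    using assms by (simp add: vec_eq_iff forall_3 conic_form_def)
  then show ?thesis by blast
next
  case False
  then have "s = (s $ 1) *s conic_point (Some (s $ 2 / s $ 1))"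
    using assms by (simp add: vec_eq_iff forall_3 conic_form_def field_simps power2_eq_square)
  then show ?thesis by blast
qed

section \<open>Secants and tangents through a given point\<close>

text \<open>The coefficients are nonzero because they correspond to the two nonzero entries of a
  vector of weight two.\<close>

definition secant :: "'a::field ^ 3 \<Rightarrow> 'a option \<Rightarrow> 'a option \<Rightarrow> bool" where
  "secant s i k \<longleftrightarrow> i \<noteq> k \<and> (\<exists>a b. a \<noteq> 0 \<and> b \<noteq> 0 \<and> s = a *s conic_point i + b *s conic_point k)"

lemma secant_sym: "secant s i k \<Longrightarrow> secant s k i"
  unfolding secant_def by (metis add.commute)

lemma conic_polar_sum:
  "conic_polar (a *s conic_point i + b *s conic_point k) (conic_point i) =
    b * conic_polar (conic_point k) (conic_point i)"
  by (simp add: conic_polar_add conic_polar_scale)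

text \<open>The factor \<open>a\<close> is kept apart so that the coefficient at point
  \<open>i\<close> can be read off as
  \<open>conic_form s / conic_polar s (conic_point i)\<close>.\<close>

lemma conic_form_sum:
  "conic_form (a *s conic_point i + b *s conic_point k) =
    a * conic_polar (a *s conic_point i + b *s conic_point k) (conic_point i)"
  unfolding conic_polar_sum
  by (simp add: conic_form_add conic_form_scale conic_polar_scale conic_polar_scale_right
      conic_polar_commute[of "conic_point i"])

lemma secant_imp_polar: "secant s i k \<Longrightarrow> conic_polar s (conic_point i) \<noteq> 0"
  by (auto simp: secant_def conic_polar_sum)

lemma secant_imp_form: "secant s i k \<Longrightarrow> conic_form s \<noteq> 0"
  using secant_imp_polar[of s i k] by (auto simp: secant_def conic_form_sum)

text \<open>A line through point \<open>i\<close> other than the tangent meets the conic again: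
  \<open>a\<close> makes \<open>conic_form u = conic_form s - a * conic_polar s (conic_point
  i)\<close> vanish.\<close>

lemma ex_secant:
  assumes "conic_form s \<noteq> 0" "conic_polar s (conic_point i) \<noteq> 0"
  shows "\<exists>k. secant s i k"
proof -
  \<comment> \<open>\<open>u\<close> is the second intersection of the line through \<open>s\<close> and \<open>conic_point i\<close> with the conic.\<close>
  define a where "a = conic_form s / conic_polar s (conic_point i)"
  define u where "u = s + (- a) *s conic_point i"
  have "conic_form u = 0"
    unfolding u_def conic_form_add conic_form_scale conic_polar_scale_right
    using assms(2) by (simp add: a_def)
  then obtain b k where u: "u = b *s conic_point k"
    using conic_form_eq_0 by blast
  have s: "s = a *s conic_point i + b *s conic_point k"
    unfolding u[symmetric] u_def by (simp add: vec_eq_iff)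
  have "a \<noteq> 0"
    using assms by (simp add: a_def)
  moreover have "b \<noteq> 0" "i \<noteq> k"
    using assms(2) unfolding s conic_polar_sum by auto
  ultimately show ?thesis
    using s secant_def by blast
qed

text \<open>\<open>conic_form_sum\<close> fixes the coefficient at point \<open>i\<close>, hence
  also the remaining multiple of the other point.\<close>

lemma secant_unique:
  assumes "secant s i k" "secant s i k'"
  shows "k = k'"
proof -
  obtain a b where ab: "b \<noteq> 0" "s = a *s conic_point i + b *s conic_point k"
    using assms(1) unfolding secant_def by blast
  obtain a' b' where ab': "s = a' *s conic_point i + b' *s conic_point k'"
    using assms(2) unfolding secant_def by blast
  have "a * conic_polar s (conic_point i) = a' * conic_polar s (conic_point i)"
    using conic_form_sum[of a i b k] conic_form_sum[of a' i b' k'] ab ab' by simp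
  then have "a = a'"
    using secant_imp_polar[OF assms(1)] by simp
  then have "b *s conic_point k = b' *s conic_point k'"
    using ab ab' by simp
  then show ?thesis
    using scaled_conic_point_eq(1) ab(1) by blast
qed

text \<open>By \<open>ex_secant\<close>, \<open>secant_unique\<close> and \<open>secant_sym\<close>
  the points whose tangent misses \<open>s\<close> are paired off. Excluding \<open>p\<close> costs
  \<open>p\<close> and its partner, unless the tangent at \<open>p\<close> passes through
  \<open>s\<close>.\<close>

lemma card_secant_points:
  fixes s :: "'a::{field,finite} ^ 3"
  assumes "conic_form s \<noteq> 0"
  shows "card {i. i \<noteq> p \<and> (\<exists>k. k \<noteq> p \<and> secant s i k)} +
      (if conic_polar s (conic_point p) = 0 then 0 else 2) +
      card {i. conic_polar s (conic_point i) = 0} = CARD('a) + 1"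
proof -
  define M where "M = {i. conic_polar s (conic_point i) \<noteq> 0}"
  have M: "M = {i. \<exists>k. secant s i k}"
    using assms ex_secant secant_imp_polar unfolding M_def by blast
  have "- M = {i. conic_polar s (conic_point i) = 0}"
    unfolding M_def by auto
  moreover have "card M + card (- M) = CARD('a option)"
    using card_Un_disjoint[of M "- M"] by simp
  ultimately have cM: "card M + card {i. conic_polar s (conic_point i) = 0} = CARD('a) + 1"
    by simp
  show ?thesis
  proof (cases "p \<in> M")
    case False
    then have "{i. i \<noteq> p \<and> (\<exists>k. k \<noteq> p \<and> secant s i k)} = M"
    proof -
      have "\<not> secant s i p" for i
        using False secant_sym[of s i p] unfolding M by blast
      then show ?thesis
        using False unfolding M by (metis (no_types, lifting) mem_Collect_eq)
    qed
    then show ?thesis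
      using cM False by (simp add: M_def)
  next
    case True
    then obtain r where r: "secant s p r"
      unfolding M by blast
    then have "r \<noteq> p"
      by (auto simp: secant_def)
    have "r \<in> M"
      unfolding M using secant_sym[OF r] by blast
    have "{i. i \<noteq> p \<and> (\<exists>k. k \<noteq> p \<and> secant s i k)} = M - {p, r}"
      proof (intro equalityI subsetI)
      fix i assume "i \<in> {i. i \<noteq> p \<and> (\<exists>k. k \<noteq> p \<and> secant s i k)}"
      then obtain k where "i \<noteq> p" "k \<noteq> p" "secant s i k"
        by blast
      then show "i \<in> M - {p, r}"
        unfolding M using secant_unique[of s r k p] secant_sym secant_sym[OF r] by blast
    next
      fix i assume i: "i \<in> M - {p, r}"
      then obtain k where k: "secant s i k"
        unfolding M by blast
      then have "k \<noteq> p"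
        using i r secant_unique[of s p i r] secant_sym[of s i p] by blast
      then show "i \<in> {i. i \<noteq> p \<and> (\<exists>k. k \<noteq> p \<and> secant s i k)}"
        using i k by blast
    qed
    moreover have "card (M - {p, r}) + 2 = card M"
      using True \<open>r \<in> M\<close> \<open>r \<noteq> p\<close> card_mono[of M "{p, r}"] by (simp add: card_Diff_subset)
    ultimately show ?thesis
      using cM True by (simp add: M_def)
  qed
qed

text \<open>Tangency is an equation of degree at most two in \<open>t\<close>; for
  \<open>s $ 1 = 0\<close> it is linear, but the point at infinity satisfies it too. The assumption
  excludes that it holds identically.\<close>

lemma card_tangents_le:
  fixes s :: "'a::{field,finite} ^ 3"
  assumes "conic_polar s (conic_point j) \<noteq> 0"
  shows "card {i. conic_polar s (conic_point i) = 0} \<le> 2"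
proof (cases "s $ 1 = 0")
  case False
  let ?P = "[:- s $ 3, 2 * s $ 2, - s $ 1:]"
  have "i \<in> Some ` {t. poly ?P t = 0}" if "conic_polar s (conic_point i) = 0" for i
    using that False
    by (cases i) (auto simp: conic_polar_point_Some conic_polar_point_None power2_eq_square
        algebra_simps simp del: conic_point.simps)
  then have "card {i. conic_polar s (conic_point i) = 0} \<le> card (Some ` {t. poly ?P t = 0})"
    by (intro card_mono) auto
  also have "\<dots> \<le> card {t. poly ?P t = 0}"
    by (intro card_image_le) simp
  also have "\<dots> \<le> degree ?P"
    using False by (intro card_poly_roots_bound) auto
  also have "\<dots> \<le> 2"
    by simp
  finally show ?thesis .
next
  case True
  have "{i. conic_polar s (conic_point i) = 0} \<subseteq> {None, Some (s $ 3 / (2 * s $ 2))}"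
  proof
    fix i assume i: "i \<in> {i. conic_polar s (conic_point i) = 0}"
    show "i \<in> {None, Some (s $ 3 / (2 * s $ 2))}"
    proof (cases i)
      case (Some t)
      then have "2 * s $ 2 * t = s $ 3"
        using i True by (simp add: conic_polar_point_Some del: conic_point.simps)
      moreover have "2 * s $ 2 \<noteq> 0"
      proof
        assume "2 * s $ 2 = 0"
        with calculation have "s $ 3 = 0"
          by auto
        with \<open>2 * s $ 2 = 0\<close> True show False
          using assms by (simp add: conic_polar_def)
      qed
      ultimately show ?thesis
        using Some by (auto simp: field_simps)
    qed simp
  qed
  then have "card {i. conic_polar s (conic_point i) = 0} \<le> card {None, Some (s $ 3 / (2 * s $ 2))}"
    by (intro card_mono) auto
  then show ?thesis
    by simp
qed

text \<open>Testing at infinity, 0 and 1 suffices. In characteristic two the solutions are the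
  multiples of the nucleus \<open>(0, 1, 0)\<close>; otherwise only zero remains.\<close>

lemma polar_degenerate_iff:
  "(\<forall>i. conic_polar s (conic_point i) = 0) \<longleftrightarrow> s $ 1 = 0 \<and> s $ 3 = 0 \<and> 2 * s $ 2 = 0"
proof
  assume *: "\<forall>i. conic_polar s (conic_point i) = 0"
  show "s $ 1 = 0 \<and> s $ 3 = 0 \<and> 2 * s $ 2 = 0"
    using *[THEN spec, of None] *[THEN spec, of "Some 0"] *[THEN spec, of "Some 1"]
    unfolding conic_polar_point_None conic_polar_point_Some by simp
qed (simp add: conic_polar_def)

section \<open>The conic code with one point removed\<close>

lemma support_pair:
  assumes "card {j. x $ j \<noteq> 0} = 2" "j \<in> {j. x $ j \<noteq> 0}"
  obtains k where "k \<noteq> j" "{j. x $ j \<noteq> 0} = {j, k}"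
proof -
  obtain a b where "{j. x $ j \<noteq> 0} = {a, b}" "a \<noteq> b"
    using assms(1) by (auto simp: card_2_iff)
  then show ?thesis
    using assms(2) that[of a] that[of b] by auto
qed

text \<open>\<open>\<sigma>\<close> identifies coordinates with the conic points other than
  \<open>p\<close>, and \<open>\<nu>\<close> holds the column multipliers in coordinate order.
  \<open>card_ge\<close> makes both candidate values of B_2 positive and distinct.\<close>

locale punctured_conic_code = parity_check_4 H
  for H :: "'a::{field,finite} ^ 'n::finite ^ 3" +
  fixes \<nu> :: "'n \<Rightarrow> 'a" and \<sigma> :: "'n \<Rightarrow> 'a option" and p :: "'a option"
  assumes scale_nonzero: "\<nu> j \<noteq> 0"
    and points: "bij_betw \<sigma> UNIV (UNIV - {p})"
    and column_eq: "column j H = \<nu> j *s conic_point (\<sigma> j)"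
    and card_eq: "CARD('n) = CARD('a)"
    and card_ge: "5 \<le> CARD('a)"
begin

lemma inj_points: "\<sigma> i = \<sigma> j \<longleftrightarrow> i = j"
  using points by (auto simp: bij_betw_def inj_on_def)

lemma point_ne [simp]: "\<sigma> j \<noteq> p"
  using points by (auto simp: bij_betw_def)

lemma ex_index: "i \<noteq> p \<Longrightarrow> \<exists>j. \<sigma> j = i"
proof -
  assume "i \<noteq> p"
  then have "i \<in> range \<sigma>"
    using points by (simp add: bij_betw_def)
  then show "\<exists>j. \<sigma> j = i"
    by blast
qed

lemma syndrome_eq: "H *v x = (\<Sum>j\<in>UNIV. (x $ j * \<nu> j) *s conic_point (\<sigma> j))"
  by (simp add: matrix_mult_sum column_eq vec.scale_scale)

lemma syndrome_support:
  assumes "{j. x $ j \<noteq> 0} \<subseteq> J"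
  shows "H *v x = (\<Sum>j\<in>J. (x $ j * \<nu> j) *s conic_point (\<sigma> j))"
  unfolding syndrome_eq using assms by (intro sum.mono_neutral_right) auto

lemma syndrome_pair:
  assumes "{j. x $ j \<noteq> 0} \<subseteq> {j, k}" "j \<noteq> k"
  shows "H *v x = (x $ j * \<nu> j) *s conic_point (\<sigma> j) + (x $ k * \<nu> k) *s conic_point (\<sigma> k)"
  using syndrome_support[OF assms(1)] assms(2) by simp

text \<open>The two nonzero entries of a vector of weight two, times the column multipliers, are the
  coefficients of its syndrome on a secant that avoids \<open>p\<close>.\<close>

lemma secant_support:
  "\<sigma> ` (\<Union>x\<in>{x \<in> fibre H s. hamming_weight x = 2}. {j. x $ j \<noteq> 0}) =
    {i. i \<noteq> p \<and> (\<exists>k. k \<noteq> p \<and> secant s i k)}"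
proof (intro equalityI subsetI)
  fix i assume "i \<in> \<sigma> ` (\<Union>x\<in>{x \<in> fibre H s. hamming_weight x = 2}. {j. x $ j \<noteq> 0})"
  then obtain x j where x: "x \<in> fibre H s" "hamming_weight x = 2" "x $ j \<noteq> 0" "i = \<sigma> j"
    by auto
  obtain k where k: "k \<noteq> j" "{j. x $ j \<noteq> 0} = {j, k}"
    using support_pair[of x j] x by (auto simp: hamming_weight_def)
  then have "x $ k \<noteq> 0"
    by blast
  have "s = (x $ j * \<nu> j) *s conic_point (\<sigma> j) + (x $ k * \<nu> k) *s conic_point (\<sigma> k)"
    using syndrome_pair[of x j k] x(1) k by (simp add: fibre_def)
  moreover have "\<sigma> j \<noteq> \<sigma> k" "x $ j * \<nu> j \<noteq> 0" "x $ k * \<nu> k \<noteq> 0"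
    using k(1) inj_points x(3) \<open>x $ k \<noteq> 0\<close> scale_nonzero by auto
  ultimately have "secant s i (\<sigma> k)"
    unfolding secant_def x(4) by blast
  then show "i \<in> {i. i \<noteq> p \<and> (\<exists>k. k \<noteq> p \<and> secant s i k)}"
    using x(4) point_ne[of j] point_ne[of k] by blast
next
  fix i assume "i \<in> {i. i \<noteq> p \<and> (\<exists>k. k \<noteq> p \<and> secant s i k)}"
  then obtain k where "i \<noteq> p" "k \<noteq> p" and ik: "secant s i k"
    by blast
  then obtain j l where jl: "i = \<sigma> j" "k = \<sigma> l"
    using ex_index[of i] ex_index[of k] by blast
  obtain a b where ab: "a \<noteq> 0" "b \<noteq> 0" "s = a *s conic_point i + b *s conic_point k"
    using ik unfolding secant_def by blast
  have "j \<noteq> l"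
    using ik jl by (auto simp: secant_def)
  \<comment> \<open>Dividing by \<open>\<nu>\<close> undoes the column multipliers, so the two
    points receive the coefficients \<open>a\<close> and \<open>b\<close>.\<close>
  define x where "x = (\<chi> m. if m = j then a / \<nu> j else if m = l then b / \<nu> l else 0)"
  have supp: "{j. x $ j \<noteq> 0} = {j, l}"
    using ab scale_nonzero by (auto simp: x_def)
  have "H *v x = s"
  proof -
    have "x $ j * \<nu> j = a" "x $ l * \<nu> l = b"
      using \<open>j \<noteq> l\<close> scale_nonzero by (simp_all add: x_def)
    then show ?thesis
      using syndrome_pair[of x j l] \<open>j \<noteq> l\<close> supp ab(3) jl by simp
  qed
  moreover have "hamming_weight x = 2"
    using supp \<open>j \<noteq> l\<close> by (simp add: hamming_weight_def)
  ultimately have "x \<in> {x \<in> fibre H s. hamming_weight x = 2}"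
    by (simp add: fibre_def)
  moreover have "x $ j \<noteq> 0"
    using supp by blast
  ultimately show "i \<in> \<sigma> ` (\<Union>x\<in>{x \<in> fibre H s. hamming_weight x = 2}. {j. x $ j \<noteq> 0})"
    unfolding jl by blast
qed

text \<open>Two weight-two vectors of one coset have disjoint supports, since the minimum distance is four.\<close>

lemma card_weight_2_fibre:
  "2 * card {x \<in> fibre H s. hamming_weight x = 2} = card {i. i \<noteq> p \<and> (\<exists>k. k \<noteq> p \<and> secant s i k)}"
proof -
  let ?X = "{x \<in> fibre H s. hamming_weight x = 2}"
  have disj: "{j. x $ j \<noteq> 0} \<inter> {j. y $ j \<noteq> 0} = {}" if "x \<in> ?X" "y \<in> ?X" "x \<noteq> y" for x y
  proof (rule ccontr)
    assume "{j. x $ j \<noteq> 0} \<inter> {j. y $ j \<noteq> 0} \<noteq> {}"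
    then have "card ({j. x $ j \<noteq> 0} \<inter> {j. y $ j \<noteq> 0}) \<ge> 1"
      by (simp add: Suc_le_eq card_gt_0_iff)
    then have "card ({j. x $ j \<noteq> 0} \<union> {j. y $ j \<noteq> 0}) \<le> 3"
      using card_Un_Int[of "{j. x $ j \<noteq> 0}" "{j. y $ j \<noteq> 0}"] that
      by (simp add: hamming_weight_def)
    then show False
      using fibre_unique[of x s y] that by simp
  qed
  have "card {i. i \<noteq> p \<and> (\<exists>k. k \<noteq> p \<and> secant s i k)} = card (\<Union>x\<in>?X. {j. x $ j \<noteq> 0})"
    unfolding secant_support[symmetric]
    by (intro card_image) (auto simp: inj_on_def inj_points)
  also have "\<dots> = (\<Sum>x\<in>?X. card {j. x $ j \<noteq> 0})"
    using disj by (intro card_UN_disjoint) auto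
  also have "\<dots> = 2 * card ?X"
    by (simp add: hamming_weight_def)
  finally show ?thesis
    by simp
qed

section \<open>Syndromes of each weight, described by the conic\<close>

lemma syndromes_2_iff: "s \<in> syndromes 2 \<longleftrightarrow> card {x \<in> fibre H s. hamming_weight x = 2} \<noteq> 0"
proof -
  have "s \<in> syndromes 2 \<longleftrightarrow> {x \<in> fibre H s. hamming_weight x = 2} \<noteq> {}"
    unfolding syndromes_def mem_Collect_eq coset_weight_fibre_iff[OF order_refl] by blast
  then show ?thesis
    by (simp only: card_0_eq finite)
qed

lemma secant_count:
  assumes "conic_form s \<noteq> 0"
  shows "2 * card {x \<in> fibre H s. hamming_weight x = 2} +
      (if conic_polar s (conic_point p) = 0 then 0 else 2) +
      card {i. conic_polar s (conic_point i) = 0} = CARD('a) + 1"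
  unfolding card_weight_2_fibre by (rule card_secant_points[OF assms])

text \<open>For the harder inclusion, at most two tangents pass through \<open>s\<close> and
  excluding \<open>p\<close> costs at most two points. At least \<open>q - 3\<close> points remain
  on secants, which is positive.\<close>

lemma syndromes_2_eq:
  "syndromes 2 = {s. conic_form s \<noteq> 0 \<and> (\<exists>i. conic_polar s (conic_point i) \<noteq> 0)}"
proof (intro equalityI subsetI)
  fix s assume "s \<in> syndromes 2"
  then have "card {i. i \<noteq> p \<and> (\<exists>k. k \<noteq> p \<and> secant s i k)} \<noteq> 0"
    unfolding syndromes_2_iff using card_weight_2_fibre[of s] by linarith
  then have "{i. i \<noteq> p \<and> (\<exists>k. k \<noteq> p \<and> secant s i k)} \<noteq> {}"
    by (rule contrapos_nn) (simp only: card.empty)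
  then obtain i k where "secant s i k"
    by blast
  then show "s \<in> {s. conic_form s \<noteq> 0 \<and> (\<exists>i. conic_polar s (conic_point i) \<noteq> 0)}"
    using secant_imp_form secant_imp_polar by blast
next
  fix s :: "'a ^ 3" assume "s \<in> {s. conic_form s \<noteq> 0 \<and> (\<exists>i. conic_polar s (conic_point i) \<noteq> 0)}"
  then obtain i where s: "conic_form s \<noteq> 0" "conic_polar s (conic_point i) \<noteq> 0"
    by blast
  show "s \<in> syndromes 2"
    unfolding syndromes_2_iff
  proof -
    have "CARD('a) \<le> 2 * card {x \<in> fibre H s. hamming_weight x = 2} + 3"
      using secant_count[OF s(1)] card_tangents_le[OF s(2)] by (auto split: if_splits)
    then show "card {x \<in> fibre H s. hamming_weight x = 2} \<noteq> 0"
      using card_ge by linarith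
  qed
qed

text \<open>Twice the number lies between \<open>q - 3\<close> and \<open>q\<close>, which leaves
  exactly two values for either parity of \<open>q\<close>.\<close>

lemma card_weight_2_cases:
  assumes "s \<in> syndromes 2"
  shows "card {x \<in> fibre H s. hamming_weight x = 2} \<in> {CARD('a) div 2, CARD('a) div 2 - 1}"
proof -
  obtain i where s: "conic_form s \<noteq> 0" "conic_polar s (conic_point i) \<noteq> 0"
    using assms by (auto simp: syndromes_2_eq)
  let ?N = "card {x \<in> fibre H s. hamming_weight x = 2}"
  have "CARD('a) \<le> 2 * ?N + 3" "2 * ?N \<le> CARD('a)"
  proof -
    show "CARD('a) \<le> 2 * ?N + 3"
      using secant_count[OF s(1)] card_tangents_le[OF s(2)] by (auto split: if_splits)
    show "2 * ?N \<le> CARD('a)"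
    proof (cases "conic_polar s (conic_point p) = 0")
      case True
      \<comment> \<open>The tangent at \<open>p\<close> is itself counted, which makes up for the
        pair that is not lost.\<close>
      then have "card {i. conic_polar s (conic_point i) = 0} > 0"
        by (auto simp: card_gt_0_iff)
      then show ?thesis
        using secant_count[OF s(1)] True by simp
    next
      case False
      then show ?thesis
        using secant_count[OF s(1)] by simp
    qed
  qed
  then show ?thesis
    by auto
qed

lemma syndromes_1_eq: "syndromes 1 = {s. \<exists>b i. b \<noteq> 0 \<and> i \<noteq> p \<and> s = b *s conic_point i}"
proof (intro equalityI subsetI)
  fix s assume "s \<in> syndromes 1"
  then obtain x where x: "x \<in> fibre H s" "hamming_weight x = 1"
    by (auto simp: syndromes_def coset_weight_fibre_iff)
  then obtain j where j: "{j. x $ j \<noteq> 0} = {j}"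
    by (auto simp: hamming_weight_def card_1_singleton_iff)
  then have "x $ j \<noteq> 0"
    by blast
  moreover have "s = (x $ j * \<nu> j) *s conic_point (\<sigma> j)"
    using syndrome_support[of x "{j}"] j x by (simp add: fibre_def)
  ultimately show "s \<in> {s. \<exists>b i. b \<noteq> 0 \<and> i \<noteq> p \<and> s = b *s conic_point i}"
    using scale_nonzero[of j] point_ne[of j] by (metis (mono_tags, lifting) mem_Collect_eq mult_eq_0_iff)
next
  fix s assume "s \<in> {s. \<exists>b i. b \<noteq> 0 \<and> i \<noteq> p \<and> s = b *s conic_point i}"
  then obtain b j where s: "b \<noteq> 0" "s = b *s conic_point (\<sigma> j)"
    using ex_index by blast
  define x where "x = (\<chi> m. if m = j then b / \<nu> j else 0)"
  have supp: "{j. x $ j \<noteq> 0} = {j}"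
    using s scale_nonzero by (auto simp: x_def)
  have "H *v x = s"
    using syndrome_support[of x "{j}"] supp s scale_nonzero by (simp add: x_def)
  moreover have "hamming_weight x = 1"
    using supp by (simp add: hamming_weight_def)
  ultimately have "\<exists>x\<in>fibre H s. hamming_weight x = 1"
    by (auto simp: fibre_def)
  then show "s \<in> syndromes 1"
    by (simp add: syndromes_def coset_weight_fibre_iff)
qed

text \<open>Point \<open>p\<close> has no column of its own and, being on the conic, lies on no
  secant in the sense of \<open>secant\<close>. The second set is the nucleus, which is on tangents
  only. All other nonzero syndromes have weight one or two.\<close>

lemma syndromes_3_eq:
  "syndromes 3 = {b *s conic_point p | b. b \<noteq> 0} \<union>
    {s. s \<noteq> 0 \<and> (\<forall>i. conic_polar s (conic_point i) = 0)}"
proof -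
  have s3: "s \<in> syndromes 3 \<longleftrightarrow> s \<noteq> 0 \<and> s \<notin> syndromes 1 \<and> s \<notin> syndromes 2" for s
    using coset_weight_fibre_le_3[of s] coset_weight_fibre_0_iff[of s] by (auto simp: syndromes_def)
  show ?thesis
  proof (intro equalityI subsetI)
    fix s assume s: "s \<in> syndromes 3"
    show "s \<in> {b *s conic_point p | b. b \<noteq> 0} \<union> {s. s \<noteq> 0 \<and> (\<forall>i. conic_polar s (conic_point i) = 0)}"
    proof (cases "conic_form s = 0")
      case True
      then obtain b i where bi: "s = b *s conic_point i"
        using conic_form_eq_0 by blast
      then have "b \<noteq> 0"
        using s s3 by auto
      then have "i = p"
        using s bi unfolding s3 syndromes_1_eq by blast
      then show ?thesis
        using bi \<open>b \<noteq> 0\<close> by blast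
    next
      case False
      then show ?thesis
        using s unfolding s3 syndromes_2_eq by blast
    qed
  next
    fix s assume "s \<in> {b *s conic_point p | b. b \<noteq> 0} \<union> {s. s \<noteq> 0 \<and> (\<forall>i. conic_polar s (conic_point i) = 0)}"
    then show "s \<in> syndromes 3"
    proof
      assume "s \<in> {b *s conic_point p | b. b \<noteq> 0}"
      then obtain b where b: "s = b *s conic_point p" "b \<noteq> 0"
        by blast
      have "s \<notin> syndromes 1"
      proof
        assume "s \<in> syndromes 1"
        then obtain c i where "i \<noteq> p" "s = c *s conic_point i"
          unfolding syndromes_1_eq by blast
        then show False
          using scaled_conic_point_eq(1)[of b p c i] b by simp
      qed
      moreover have "s \<notin> syndromes 2"
        unfolding syndromes_2_eq using b by (simp add: conic_form_scale)
      moreover have "s \<noteq> 0"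
        using b by simp
      ultimately show ?thesis
        by (simp add: s3)
    next
      assume s: "s \<in> {s. s \<noteq> 0 \<and> (\<forall>i. conic_polar s (conic_point i) = 0)}"
      then have "s $ 1 = 0" "s $ 3 = 0"
        using polar_degenerate_iff[of s] by auto
      \<comment> \<open>Only the middle coordinate of \<open>s\<close> survives, and
        \<open>conic_form s\<close> is its square.\<close>
      then have "conic_form s \<noteq> 0"
        using s by (auto simp: conic_form_def vec_eq_iff forall_3)
      then have "s \<notin> syndromes 1"
        unfolding syndromes_1_eq by (auto simp: conic_form_scale)
      moreover have "s \<notin> syndromes 2"
        unfolding syndromes_2_eq using s by blast
      ultimately show ?thesis
        using s by (simp add: s3)
    qed
  qed
qed

section \<open>Parity of the field order, and the nucleus\<close>

text \<open>By \<open>secant_count\<close> the number of tangents through a point off the conic has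
  the parity of \<open>q + 1\<close>. In characteristic two \<open>(1, 0, 1)\<close> lies on one
  tangent; otherwise \<open>(0, 1, 0)\<close> lies on two.\<close>

lemma even_card_field_iff: "even CARD('a) \<longleftrightarrow> (2 :: 'a) = 0"
proof
  assume "(2 :: 'a) = 0"
  define s :: "'a ^ 3" where "s = vector [1, 0, 1]"
  have "{i. conic_polar s (conic_point i) = 0} = {Some 1}"
  proof -
    have "conic_polar s (conic_point (Some t)) = 0 \<longleftrightarrow> t = 1" for t
    proof -
      have "conic_polar s (conic_point (Some t)) = - ((t - 1) ^ 2) - 2 * t"
        unfolding conic_polar_point_Some by (simp add: s_def power2_eq_square algebra_simps)
      then show ?thesis
        using \<open>(2 :: 'a) = 0\<close> by simp
    qed
    moreover have "conic_polar s (conic_point None) \<noteq> 0"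
      unfolding conic_polar_point_None by (simp add: s_def)
    ultimately have "conic_polar s (conic_point i) = 0 \<longleftrightarrow> i = Some 1" for i
      by (cases i) (simp_all del: conic_point.simps)
    then show ?thesis
      by blast
  qed
  moreover have "conic_form s \<noteq> 0"
    by (simp add: s_def conic_form_def)
  ultimately have "2 * card {x \<in> fibre H s. hamming_weight x = 2} +
      (if conic_polar s (conic_point p) = 0 then 0 else 2) + 1 = CARD('a) + 1"
    using secant_count[of s] by simp
  then have "CARD('a) = 2 * card {x \<in> fibre H s. hamming_weight x = 2} +
      (if conic_polar s (conic_point p) = 0 then 0 else 2)"
    by linarith
  then show "even CARD('a)"
    by simp
next
  assume "even CARD('a)"
  show "(2 :: 'a) = 0"
  proof (rule ccontr)
    assume "(2 :: 'a) \<noteq> 0"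
    define s :: "'a ^ 3" where "s = vector [0, 1, 0]"
    have "{i. conic_polar s (conic_point i) = 0} = {None, Some 0}"
    proof -
      have "conic_polar s (conic_point (Some t)) = 0 \<longleftrightarrow> t = 0" for t
        unfolding conic_polar_point_Some using \<open>(2 :: 'a) \<noteq> 0\<close> by (simp add: s_def)
      moreover have "conic_polar s (conic_point None) = 0"
        unfolding conic_polar_point_None by (simp add: s_def)
      ultimately have "conic_polar s (conic_point i) = 0 \<longleftrightarrow> i \<in> {None, Some 0}" for i
        by (cases i) (simp_all del: conic_point.simps)
      then show ?thesis
        by blast
    qed
    moreover have "conic_form s \<noteq> 0"
      by (simp add: s_def conic_form_def)
    ultimately have "2 * card {x \<in> fibre H s. hamming_weight x = 2} +
        (if conic_polar s (conic_point p) = 0 then 0 else 2) + 2 = CARD('a) + 1"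
      using secant_count[of s] by simp
    then have "CARD('a) + 1 = 2 * card {x \<in> fibre H s. hamming_weight x = 2} +
        (if conic_polar s (conic_point p) = 0 then 0 else 2) + 2"
      by linarith
    then have "even (CARD('a) + 1)"
      by simp
    then show False
      using \<open>even CARD('a)\<close> by simp
  qed
qed

lemma card_conic_multiples: "card {b *s conic_point p | b. b \<noteq> 0} = CARD('a) - 1"
proof -
  have "{b *s conic_point p | b. b \<noteq> 0} = (\<lambda>b. b *s conic_point p) ` (- {0})"
    by auto
  moreover have "inj_on (\<lambda>b. b *s conic_point p) (- {0})"
    using scaled_conic_point_eq(2) by (intro inj_onI) blast
  ultimately show ?thesis
    by (simp add: card_image Compl_eq_Diff_UNIV card_Diff_subset)
qed

lemma card_nucleus:
  "card {s :: 'a ^ 3. s \<noteq> 0 \<and> (\<forall>i. conic_polar s (conic_point i) = 0)} =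
    (if even CARD('a) then CARD('a) - 1 else 0)"
proof (cases "even CARD('a)")
  case True
  then have two: "(2 :: 'a) = 0"
    by (simp add: even_card_field_iff)
  have "{s :: 'a ^ 3. s \<noteq> 0 \<and> (\<forall>i. conic_polar s (conic_point i) = 0)} =
      (\<lambda>a. vector [0, a, 0]) ` (- {0})"
    unfolding polar_degenerate_iff two
    by (auto simp: vec_eq_iff forall_3 image_iff)
  moreover have "inj_on (\<lambda>a :: 'a. vector [0, a, 0] :: 'a ^ 3) (- {0})"
    by (rule inj_onI) (metis vector_3(2))
  ultimately show ?thesis
    using True by (simp add: card_image Compl_eq_Diff_UNIV card_Diff_subset)
next
  case False
  then have "(2 :: 'a) \<noteq> 0"
    by (simp add: even_card_field_iff)
  then have "{s :: 'a ^ 3. s \<noteq> 0 \<and> (\<forall>i. conic_polar s (conic_point i) = 0)} = {}"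
    unfolding polar_degenerate_iff by (auto simp: vec_eq_iff forall_3)
  then show ?thesis
    using False by simp
qed

lemma card_syndromes_3:
  "card (syndromes 3) = (if even CARD('a) then 2 else 1) * (CARD('a) - 1)"
proof -
  have "{b *s conic_point p | b. b \<noteq> 0} \<inter> {s. s \<noteq> 0 \<and> (\<forall>i. conic_polar s (conic_point i) = 0)} = {}"
  proof -
    \<comment> \<open>A second conic point separates the sets: it pairs to zero with the nucleus but
      not with a nonzero multiple of point \<open>p\<close>.\<close>
    obtain i where "i \<noteq> p"
      using that[of None] that[of "Some 0"] by (cases p) auto
    then have "conic_polar (b *s conic_point p) (conic_point i) \<noteq> 0" if "b \<noteq> 0" for b
      using that by (simp add: conic_polar_scale)
    then show ?thesis
      by blast
  qed
  then have "card (syndromes 3) = card {b *s conic_point p | b. b \<noteq> 0} +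
      card {s :: 'a ^ 3. s \<noteq> 0 \<and> (\<forall>i. conic_polar s (conic_point i) = 0)}"
    unfolding syndromes_3_eq by (intro card_Un_disjoint) auto
  then show ?thesis
    unfolding card_conic_multiples card_nucleus by (cases "even CARD('a)") auto
qed

section \<open>Sizes of the two classes of weight two\<close>

definition syndromes_2_of :: "nat \<Rightarrow> ('a ^ 3) set" where
  "syndromes_2_of i = {s \<in> syndromes 2. card {x \<in> fibre H s. hamming_weight x = 2} = i}"

text \<open>Disjointness relies on \<open>m > 0\<close>, which \<open>card_ge\<close> provides,
  since \<open>m - 1\<close> is truncated.\<close>

lemma syndromes_2_partition:
  defines "m \<equiv> CARD('a) div 2"
  shows "syndromes 2 = syndromes_2_of m \<union> syndromes_2_of (m - 1)"
    and "syndromes_2_of m \<inter> syndromes_2_of (m - 1) = {}"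
  using card_weight_2_cases card_ge unfolding m_def syndromes_2_of_def by auto

text \<open>Two linear equations that determine the class sizes: the first counts all syndromes, the
  second all vectors of weight two.\<close>

lemma card_syndromes_2_classes:
  fixes q m :: nat
  defines "q \<equiv> CARD('a)"
  defines "m \<equiv> q div 2"
  shows "card (syndromes_2_of m) + card (syndromes_2_of (m - 1)) + 1 + q * (q - 1) +
      (if even q then 2 else 1) * (q - 1) = q ^ 3"
    and "m * card (syndromes_2_of m) + (m - 1) * card (syndromes_2_of (m - 1)) =
      (q choose 2) * (q - 1) ^ 2"
proof -
  have *: "card (syndromes 2) = card (syndromes_2_of m) + card (syndromes_2_of (m - 1))"
    using syndromes_2_partition card_Un_disjoint[of "syndromes_2_of m" "syndromes_2_of (m - 1)"]
    unfolding m_def q_def by simp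
  show "card (syndromes_2_of m) + card (syndromes_2_of (m - 1)) + 1 + q * (q - 1) +
      (if even q then 2 else 1) * (q - 1) = q ^ 3"
    using sum_card_syndromes card_syndromes[of 0] card_syndromes[of 1]
    unfolding card_syndromes_3 * card_eq q_def by simp
  have "(q choose 2) * (q - 1) ^ 2 = (\<Sum>s\<in>syndromes 2. card {x \<in> fibre H s. hamming_weight x = 2})"
    using sum_card_weight_2 by (simp add: card_eq q_def)
  also have "\<dots> = (\<Sum>s\<in>syndromes_2_of m. card {x \<in> fibre H s. hamming_weight x = 2}) +
      (\<Sum>s\<in>syndromes_2_of (m - 1). card {x \<in> fibre H s. hamming_weight x = 2})"
    using syndromes_2_partition unfolding m_def q_def by (simp add: sum.union_disjoint)
  also have "\<dots> = (\<Sum>s\<in>syndromes_2_of m. m) + (\<Sum>s\<in>syndromes_2_of (m - 1). m - 1)"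
    by (intro arg_cong2[of _ _ _ _ "(+)"] sum.cong) (auto simp: syndromes_2_of_def)
  finally show "m * card (syndromes_2_of m) + (m - 1) * card (syndromes_2_of (m - 1)) =
      (q choose 2) * (q - 1) ^ 2"
    by (simp add: mult.commute)
qed

lemma card_classes_odd:
  fixes q :: nat
  defines "q \<equiv> CARD('a)"
  assumes "odd q"
  shows "card (syndromes_2_of (q div 2)) = (q - 1) * ((q ^ 2 + q) div 2)"
    and "card (syndromes_2_of (q div 2 - 1)) = (q - 1) * ((q ^ 2 - q) div 2)"
proof -
  \<comment> \<open>Now \<open>q div 2\<close> is \<open>l + 1\<close> and
    \<open>q div 2 - 1\<close> is \<open>l\<close>, free of subtraction.\<close>
  obtain l where q: "q = 2 * l + 3"
  proof -
    have "q = 2 * ((q - 3) div 2) + 3"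
      using assms(2) card_ge unfolding q_def by presburger
    then show ?thesis
      using that by blast
  qed
  define a b where "a = card (syndromes_2_of (q div 2))" and "b = card (syndromes_2_of (q div 2 - 1))"
  have choose: "q choose 2 = (2 * l + 3) * (l + 1)"
    unfolding choose_two q by simp
  have sum: "a + b = (2 * l + 2) * (2 * l + 3) ^ 2"
    using card_syndromes_2_classes(1)[folded q_def, folded a_def b_def] assms(2) unfolding q
    by (simp add: power2_eq_square power3_eq_cube algebra_simps)
  have weighted: "(l + 1) * a + l * b = (2 * l + 3) * (l + 1) * (2 * l + 2) ^ 2"
    using card_syndromes_2_classes(2)[folded q_def, folded a_def b_def, unfolded choose] unfolding q by simp
  \<comment> \<open>Removing \<open>l\<close> times the sum equation isolates
    \<open>a\<close>.\<close>
  have "(l + 1) * a + l * b = a + l * (a + b)"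
    by (simp add: algebra_simps)
  then have a: "a = (2 * l + 2) * ((2 * l + 3) * (l + 2))"
    using weighted unfolding sum by (simp add: power2_eq_square algebra_simps)
  then have b: "b = (2 * l + 2) * ((2 * l + 3) * (l + 1))"
    using sum by (simp add: power2_eq_square algebra_simps)
  have "q ^ 2 + q = 2 * ((2 * l + 3) * (l + 2))" "q ^ 2 - q = 2 * ((2 * l + 3) * (l + 1))"
    by (simp_all add: q power2_eq_square algebra_simps)
  then have "a = (q - 1) * ((q ^ 2 + q) div 2)" "b = (q - 1) * ((q ^ 2 - q) div 2)"
    unfolding a b by (simp_all add: q)
  then show "card (syndromes_2_of (q div 2)) = (q - 1) * ((q ^ 2 + q) div 2)"
    "card (syndromes_2_of (q div 2 - 1)) = (q - 1) * ((q ^ 2 - q) div 2)"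
    unfolding a_def b_def .
qed

text \<open>The elimination is that of the odd case, but the multiples of the nucleus also leave the
  total, which changes the sum equation.\<close>

lemma card_classes_even:
  fixes q :: nat
  defines "q \<equiv> CARD('a)"
  assumes "even q"
  shows "card (syndromes_2_of (q div 2)) = (q - 1) ^ 2"
    and "card (syndromes_2_of (q div 2 - 1)) = (q - 1) * (q ^ 2 - q)"
proof -
  obtain l where q: "q = 2 * l + 2"
  proof -
    have "q = 2 * ((q - 2) div 2) + 2"
      using assms(2) card_ge unfolding q_def by presburger
    then show ?thesis
      using that by blast
  qed
  define a b where "a = card (syndromes_2_of (q div 2))" and "b = card (syndromes_2_of (q div 2 - 1))"
  have choose: "q choose 2 = (l + 1) * (2 * l + 1)"
    unfolding choose_two q by simp
  have sum: "a + b = (2 * l + 1) ^ 2 * (2 * l + 3)"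
    using card_syndromes_2_classes(1)[folded q_def, folded a_def b_def] assms(2) unfolding q
    by (simp add: power2_eq_square power3_eq_cube algebra_simps)
  have weighted: "(l + 1) * a + l * b = (l + 1) * (2 * l + 1) * (2 * l + 1) ^ 2"
    using card_syndromes_2_classes(2)[folded q_def, folded a_def b_def, unfolded choose] unfolding q by simp
  have "(l + 1) * a + l * b = a + l * (a + b)"
    by (simp add: algebra_simps)
  then have a: "a = (2 * l + 1) ^ 2"
    using weighted unfolding sum by (simp add: power2_eq_square algebra_simps)
  then have b: "b = (2 * l + 1) * ((2 * l + 2) * (2 * l + 1))"
    using sum by (simp add: power2_eq_square algebra_simps)
  have "q ^ 2 - q = (2 * l + 2) * (2 * l + 1)"
    by (simp add: q power2_eq_square algebra_simps)
  then have "a = (q - 1) ^ 2" "b = (q - 1) * (q ^ 2 - q)"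
    unfolding a b by (simp_all add: q)
  then show "card (syndromes_2_of (q div 2)) = (q - 1) ^ 2"
    "card (syndromes_2_of (q div 2 - 1)) = (q - 1) * (q ^ 2 - q)"
    unfolding a_def b_def .
qed

end

section \<open>From the given code to its syndromes, and the final assembly\<close>

lemma linear_code_min_weight:
  assumes "linear_code n k d q C" "x \<in> C" "x \<noteq> 0"
  shows "d \<le> hamming_weight x"
proof -
  have "0 \<in> C" "min_distance C = d"
    using assms(1) vec.subspace_0 by (auto simp: linear_code_def)
  moreover have "hamming_dist x 0 = hamming_weight x"
    by (simp add: hamming_dist_def hamming_weight_def)
  ultimately show ?thesis
    using assms(2,3) unfolding min_distance_def by (metis (mono_tags, lifting) Least_le)
qed

theorem theorem6p8:
  fixes C :: "('a::{field,finite} ^ 'n::finite) set"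
    and H :: "'a ^ 'n ^ 3"
    and \<mu> :: "'a option \<Rightarrow> 'a"
    and p :: "'a option"
    and q n :: nat
  assumes "q \<ge> 5"
    and "n = q"
    and "linear_code q (q - 3) 4 q C"
    and "\<forall>j. \<mu> j \<noteq> 0"
    and "column_removed (H4 \<mu>) p H"
    and "parity_check_matrix H C"
  shows "covering_radius C = 3 \<and>
    card (cosets_of_weight C 1) = q * (q - 1) \<and>
    (\<forall>V\<in>cosets_of_weight C 1. D1 C V) \<and>
    (odd q \<longrightarrow>
      (\<exists>K1 K2. cosets_of_weight C 2 = K1 \<union> K2 \<and> K1 \<inter> K2 = {} \<and>
         card K1 = (q - 1) * ((q ^ 2 + q) div 2) \<and> (\<forall>V\<in>K1. D2 C ((q - 1) div 2) V) \<and>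
         card K2 = (q - 1) * ((q ^ 2 - q) div 2) \<and> (\<forall>V\<in>K2. D2 C ((q - 3) div 2) V) \<and>
         (\<forall>Va\<in>K1. \<forall>Vb\<in>K2. \<forall>w\<in>{3..n}.
            (- 1) ^ n * weight_count Va w - weight_count Va (n + 2 - w) =
            (- 1) ^ n * weight_count Vb w - weight_count Vb (n + 2 - w))) \<and>
      card (cosets_of_weight C 3) = q - 1 \<and>
      (\<forall>V\<in>cosets_of_weight C 3. D3 C V)) \<and>
    (even q \<longrightarrow>
      (\<exists>K1 K2. cosets_of_weight C 2 = K1 \<union> K2 \<and> K1 \<inter> K2 = {} \<and>
         card K1 = (q - 1) ^ 2 \<and> (\<forall>V\<in>K1. D2 C (q div 2) V) \<and>
         card K2 = (q - 1) * (q ^ 2 - q) \<and> (\<forall>V\<in>K2. D2 C ((q - 2) div 2) V) \<and>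
         (\<forall>Va\<in>K1. \<forall>Vb\<in>K2. \<forall>w\<in>{3..n}.
            (- 1) ^ n * weight_count Va w - weight_count Va (n + 2 - w) =
            (- 1) ^ n * weight_count Vb w - weight_count Vb (n + 2 - w))) \<and>
      card (cosets_of_weight C 3) = 2 * (q - 1) \<and>
      (\<forall>V\<in>cosets_of_weight C 3. D3 C V))"
proof -
  have C: "C = fibre H 0"
    using assms(6) by (simp add: parity_check_matrix_def fibre_def)
  have q: "CARD('n) = q" "CARD('a) = q"
    using assms(3) by (auto simp: linear_code_def)
  obtain \<sigma> :: "'n \<Rightarrow> 'a option" where \<sigma>: "bij_betw \<sigma> UNIV (UNIV - {p})"
    "\<forall>j. column j H = column (\<sigma> j) (H4 \<mu>)"
    using assms(5) by (auto simp: column_removed_def)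
  \<comment> \<open>The columns of \<open>H4\<close> appear in the order \<open>\<sigma>\<close>, so
    the multipliers \<open>\<mu>\<close> are reindexed accordingly.\<close>
  interpret punctured_conic_code H "\<lambda>j. \<mu> (\<sigma> j)" \<sigma> p
  proof
    fix x :: "'a ^ 'n" assume "x \<in> fibre H 0" "x \<noteq> 0"
    then show "4 \<le> hamming_weight x"
      using linear_code_min_weight[OF assms(3)] C by blast
  next
    show "column j H = \<mu> (\<sigma> j) *s conic_point (\<sigma> j)" for j
      using \<sigma>(2) by (simp add: column_def H4_def vec_eq_iff)
  qed (use \<sigma>(1) q assms(1,4) in auto)
  \<comment> \<open>The larger value of B_2 for both parities: \<open>(q - 1) / 2\<close> for odd
    \<open>q\<close> and \<open>q / 2\<close> for even \<open>q\<close>.\<close>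
  let ?m = "q div 2"
  let ?K = "\<lambda>i. fibre H ` syndromes_2_of i"
  have K: "cosets_of_weight C 2 = ?K ?m \<union> ?K (?m - 1)" "?K ?m \<inter> ?K (?m - 1) = {}"
    unfolding C cosets_of_weight_eq
    using syndromes_2_partition q inj_fibre by (auto simp flip: image_Un image_Int)
  have K_D2: "\<forall>V\<in>?K i. D2 C i V" for i
    using D2_fibre unfolding C syndromes_2_of_def by auto
  have K_sym: "\<forall>Va\<in>?K i. \<forall>Vb\<in>?K j. \<forall>w\<in>{3..n}.
      (- 1) ^ n * weight_count Va w - weight_count Va (n + 2 - w) =
      (- 1) ^ n * weight_count Vb w - weight_count Vb (n + 2 - w)" for i j
    using reflected_weight_count unfolding syndromes_2_of_def q assms(2) by blast
  have card_3: "card (cosets_of_weight C 3) = (if even q then 2 else 1) * (q - 1)"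
    unfolding C cosets_of_weight_eq card_image_fibre using card_syndromes_3 q by simp
  have D3: "\<forall>V\<in>cosets_of_weight C 3. D3 C V"
    unfolding C cosets_of_weight_eq using D3_fibre by blast
  have "covering_radius C = 3"
    unfolding C
  proof (rule covering_radius_fibre)
    show "syndromes 3 \<noteq> {}"
      using card_syndromes_3 card_ge by (auto split: if_splits)
  qed
  moreover have "card (cosets_of_weight C 1) = q * (q - 1)"
    unfolding C cosets_of_weight_eq card_image_fibre using card_syndromes[of 1] q by simp
  moreover have "\<forall>V\<in>cosets_of_weight C 1. D1 C V"
    unfolding C cosets_of_weight_eq using D1_fibre by blast
  moreover have "\<exists>K1 K2. cosets_of_weight C 2 = K1 \<union> K2 \<and> K1 \<inter> K2 = {} \<and>
         card K1 = (q - 1) * ((q ^ 2 + q) div 2) \<and> (\<forall>V\<in>K1. D2 C ((q - 1) div 2) V) \<and>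
         card K2 = (q - 1) * ((q ^ 2 - q) div 2) \<and> (\<forall>V\<in>K2. D2 C ((q - 3) div 2) V) \<and>
         (\<forall>Va\<in>K1. \<forall>Vb\<in>K2. \<forall>w\<in>{3..n}.
            (- 1) ^ n * weight_count Va w - weight_count Va (n + 2 - w) =
            (- 1) ^ n * weight_count Vb w - weight_count Vb (n + 2 - w))"
    if "odd q"
  proof (intro exI conjI)
    have "(q - 1) div 2 = ?m" "(q - 3) div 2 = ?m - 1"
      using that by presburger+
    then show "\<forall>V\<in>?K ?m. D2 C ((q - 1) div 2) V" "\<forall>V\<in>?K (?m - 1). D2 C ((q - 3) div 2) V"
      using K_D2 by simp_all
    show "card (?K ?m) = (q - 1) * ((q ^ 2 + q) div 2)" "card (?K (?m - 1)) = (q - 1) * ((q ^ 2 - q) div 2)"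
      unfolding card_image_fibre using card_classes_odd that unfolding q by blast+
  qed (rule K K_sym)+
  moreover have "\<exists>K1 K2. cosets_of_weight C 2 = K1 \<union> K2 \<and> K1 \<inter> K2 = {} \<and>
         card K1 = (q - 1) ^ 2 \<and> (\<forall>V\<in>K1. D2 C (q div 2) V) \<and>
         card K2 = (q - 1) * (q ^ 2 - q) \<and> (\<forall>V\<in>K2. D2 C ((q - 2) div 2) V) \<and>
         (\<forall>Va\<in>K1. \<forall>Vb\<in>K2. \<forall>w\<in>{3..n}.
            (- 1) ^ n * weight_count Va w - weight_count Va (n + 2 - w) =
            (- 1) ^ n * weight_count Vb w - weight_count Vb (n + 2 - w))"
    if "even q"
  proof (intro exI conjI)
    have "(q - 2) div 2 = ?m - 1"
      by presburger
    then show "\<forall>V\<in>?K ?m. D2 C (q div 2) V" "\<forall>V\<in>?K (?m - 1). D2 C ((q - 2) div 2) V"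
      using K_D2 by simp_all
    show "card (?K ?m) = (q - 1) ^ 2" "card (?K (?m - 1)) = (q - 1) * (q ^ 2 - q)"
      unfolding card_image_fibre using card_classes_even that unfolding q by blast+
  qed (rule K K_sym)+
  ultimately show ?thesis
    using card_3 D3 by simp
qed

end
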